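(* Let $k$ be an algebraically closed field and let $X \subset \mathbb{P}^2_k$ be a set of $d$ distinct points. Fix an integer $m$ with $1 \le m < d$. Then there exists a subset $Z \subset X$ of cardinality exactly $m$ such that (1) $h_Z(t) = \min\{h_X(t), m\}$ for all $t$; and (2) for all positive integers $s$, $$\operatorname{rank} \mu_{s,Z} = \min\bigl\{\dim_k I(Z)_{s+1},\ \operatorname{rank}\mu_{s,X} + \dim_k (S_1\otimes_k I(Z)_s) - \dim_k (S_1\otimes_k I(X)_s)\bigr\}.$$
   Context: Let $S = k[x_0,x_1,x_2]$ be the homogeneous coordinate ring of $\mathbb{P}^2_k$, and let $S_t$ denote its degree $t$ part. For a finite set of points $W \subset \mathbb{P}^2_k$, $I(W)\subset S$ denotes its (saturated, radical) homogeneous ideal, $I(W)_t$ the degree $t$ part of $I(W)$, and $h_W(t) = \dim_k (S/I(W))_t$ its Hilbert function. For a positive integer $s$, $\mu_{s,W} : S_1 \otimes_k I(W)_s \to I(W)_{s+1}$ is the multiplication map $L\otimes F \mapsto LF$. *)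

theory Defs
  imports
    "HOL-Algebra.Embedded_Algebras"
    "HOL-Algebra.QuotRing"
    "HOL-Analysis.Finite_Cartesian_Product"
    "HOL-Computational_Algebra.Polynomial"
    "HOL-Library.Poly_Mapping"
    "HOL-Library.Product_Plus"
begin

section \<open>Vector spaces of finitely supported functions\<close>

definition pm_scale :: "'k::field \<Rightarrow> ('m \<Rightarrow>\<^sub>0 'k) \<Rightarrow> ('m \<Rightarrow>\<^sub>0 'k)" where
  "pm_scale c f = Poly_Mapping.map ((*) c) f"

lemma lookup_pm_scale [simp]: "Poly_Mapping.lookup (pm_scale c f) m = c * Poly_Mapping.lookup f m"
  by (simp add: pm_scale_def Poly_Mapping.map.rep_eq when_def)

global_interpretation pm: vector_space pm_scale
  by unfold_locales (auto intro!: poly_mapping_eqI simp: lookup_add algebra_simps)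


section \<open>The ring \<open>S = k[x\<^sub>0, x\<^sub>1, x\<^sub>2]\<close>\<close>

text \<open>The variables are indexed by the three-element type \<open>3\<close>, whose elements are
  \<open>0\<close>, \<open>1\<close> and \<open>2\<close> (with \<open>3 = 0\<close>).\<close>

type_synonym mon3 = "3 \<Rightarrow>\<^sub>0 nat"
type_synonym 'k poly3 = "mon3 \<Rightarrow>\<^sub>0 'k"

definition mdeg :: "mon3 \<Rightarrow> nat" where
  "mdeg a = (\<Sum>i\<in>UNIV. Poly_Mapping.lookup a i)"

definition homog :: "nat \<Rightarrow> 'k::field poly3 set" where
  "homog t = {f. \<forall>a\<in>Poly_Mapping.keys f. mdeg a = t}"

definition eval3 :: "'k::field poly3 \<Rightarrow> 'k ^ 3 \<Rightarrow> 'k" where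
  "eval3 f v = (\<Sum>a\<in>Poly_Mapping.keys f. Poly_Mapping.lookup f a * (\<Prod>i\<in>UNIV. (v $ i) ^ Poly_Mapping.lookup a i))"

text \<open>\<open>S\<close> as a \<open>HOL-Algebra\<close> ring, for use with its ideals, quotient rings and dimensions.\<close>

definition polyring :: "'k::field poly3 ring" where
  "polyring = \<lparr>carrier = UNIV, monoid.mult = (*), one = 1, zero = 0, add = (+)\<rparr>"

lemma cring_polyring: "cring polyring"
  unfolding polyring_def
proof (rule cringI)
  show "abelian_group \<lparr>carrier = UNIV :: 'a poly3 set, monoid.mult = (*), one = 1, zero = 0, add = (+)\<rparr>"
    by (rule abelian_groupI) (auto simp: add_ac intro: exI[of _ "- x" for x] add.right_inverse)
  show "Group.comm_monoid \<lparr>carrier = UNIV :: 'a poly3 set, monoid.mult = (*), one = 1, zero = 0, add = (+)\<rparr>"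
    by (rule comm_monoidI) (auto simp: mult_ac)
qed (auto simp: algebra_simps)

definition constants :: "'k::field poly3 set" where
  "constants = range (Poly_Mapping.single 0)"


section \<open>The projective plane and ideals of sets of points\<close>

text \<open>A point is an equivalence class of nonzero vectors, i.e. the set of all its homogeneous
  coordinate vectors.\<close>

definition proj_rel :: "('k::field ^ 3) rel" where
  "proj_rel = {(u, v). u \<noteq> 0 \<and> v \<noteq> 0 \<and> (\<exists>c. c \<noteq> 0 \<and> v = c *s u)}"

lemma equiv_proj_rel: "equiv (- {0}) (proj_rel :: ('k::field ^ 3) rel)"
proof (rule equivI)
  show "proj_rel \<subseteq> (- {0}) \<times> (- {0} :: ('k ^ 3) set)"
    by (auto simp: proj_rel_def)
  show "refl_on (- {0}) (proj_rel :: ('k ^ 3) rel)"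
    by (auto simp: refl_on_def proj_rel_def intro!: exI[of _ 1])
  show "sym (proj_rel :: ('k ^ 3) rel)"
  proof (rule symI)
    fix u v :: "'k ^ 3" assume "(u, v) \<in> proj_rel"
    then obtain c where "u \<noteq> 0" "v \<noteq> 0" "c \<noteq> 0" "v = c *s u" by (auto simp: proj_rel_def)
    then show "(v, u) \<in> proj_rel"
      by (auto simp: proj_rel_def vector_smult_assoc intro!: exI[of _ "inverse c"])
  qed
  show "trans (proj_rel :: ('k ^ 3) rel)"
  proof (rule transI)
    fix u v w :: "'k ^ 3" assume "(u, v) \<in> proj_rel" "(v, w) \<in> proj_rel"
    then obtain c c' where "u \<noteq> 0" "w \<noteq> 0" "c \<noteq> 0" "v = c *s u" "c' \<noteq> 0" "w = c' *s v"
      by (auto simp: proj_rel_def)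
    then show "(u, w) \<in> proj_rel"
      by (auto simp: proj_rel_def vector_smult_assoc intro!: exI[of _ "c' * c"])
  qed
qed

definition proj_plane :: "('k::field ^ 3) set set" where
  "proj_plane = (- {0}) // proj_rel"

definition vanishing_ideal :: "('k::field ^ 3) set set \<Rightarrow> 'k poly3 set" where
  "vanishing_ideal W =
     genideal polyring {f. (\<exists>t. f \<in> homog t) \<and> (\<forall>p\<in>W. \<forall>v\<in>p. eval3 f v = 0)}"

definition vanishing_ideal_deg :: "('k::field ^ 3) set set \<Rightarrow> nat \<Rightarrow> 'k poly3 set" where
  "vanishing_ideal_deg W t = vanishing_ideal W \<inter> homog t"

text \<open>\<open>(S/I(W))\<^sub>t\<close> is the image of \<open>S\<^sub>t\<close> in \<open>S/I(W)\<close>, and the scalars act through the image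
  of the constant polynomials.\<close>

definition hilbert_fun :: "('k::field ^ 3) set set \<Rightarrow> nat \<Rightarrow> nat" where
  "hilbert_fun W t =
     (let I = vanishing_ideal W; q = (\<lambda>f. I +>\<^bsub>polyring\<^esub> f)
      in ring.dim (polyring Quot I) (q ` constants) (q ` homog t))"


section \<open>Tensor products and the multiplication map\<close>

text \<open>As \<open>S\<close> is the free \<open>k\<close>-module on the monomials, \<open>S \<otimes>\<^sub>k S\<close> is the free \<open>k\<close>-module on pairs of
  monomials; over a field, \<open>U \<otimes>\<^sub>k V\<close> for subspaces \<open>U\<close>, \<open>V\<close> of \<open>S\<close> is the subspace of
  \<open>S \<otimes>\<^sub>k S\<close> spanned by the pure tensors (see \<open>dim_tensor_space\<close> below).\<close>

definition pure_tensor :: "'k::field poly3 \<Rightarrow> 'k poly3 \<Rightarrow> (mon3 \<times> mon3 \<Rightarrow>\<^sub>0 'k)" where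
  "pure_tensor f g =
     (\<Sum>a\<in>Poly_Mapping.keys f. \<Sum>b\<in>Poly_Mapping.keys g.
        Poly_Mapping.single (a, b) (Poly_Mapping.lookup f a * Poly_Mapping.lookup g b))"

definition tensor_space :: "'k::field poly3 set \<Rightarrow> 'k poly3 set \<Rightarrow> (mon3 \<times> mon3 \<Rightarrow>\<^sub>0 'k) set" where
  "tensor_space U V = pm.span {pure_tensor f g | f g. f \<in> U \<and> g \<in> V}"

definition mult_map :: "(mon3 \<times> mon3 \<Rightarrow>\<^sub>0 'k::field) \<Rightarrow> 'k poly3" where
  "mult_map T = (\<Sum>(a, b)\<in>Poly_Mapping.keys T. Poly_Mapping.single (a + b) (Poly_Mapping.lookup T (a, b)))"

text \<open>\<open>\<mu>\<^sub>s\<^sub>,\<^sub>W\<close> is the restriction of \<open>mult_map\<close> to the following domain.\<close>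

definition mu_domain :: "nat \<Rightarrow> ('k::field ^ 3) set set \<Rightarrow> (mon3 \<times> mon3 \<Rightarrow>\<^sub>0 'k) set" where
  "mu_domain s W = tensor_space (homog 1) (vanishing_ideal_deg W s)"

definition rank_mu :: "nat \<Rightarrow> ('k::field ^ 3) set set \<Rightarrow> nat" where
  "rank_mu s W = pm.dim (mult_map ` mu_domain s W)"

lemma lookup_pure_tensor: "Poly_Mapping.lookup (pure_tensor f g) (a, b) = Poly_Mapping.lookup f a * Poly_Mapping.lookup g b"
proof -
  have "Poly_Mapping.lookup (pure_tensor f g) (a, b) =
    (\<Sum>a'\<in>Poly_Mapping.keys f. \<Sum>b'\<in>Poly_Mapping.keys g. if a' = a then if b' = b then Poly_Mapping.lookup f a' * Poly_Mapping.lookup g b' else 0 else 0)"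
    unfolding pure_tensor_def lookup_sum
    by (intro sum.cong refl) (auto simp: lookup_single when_def)
  also have "\<dots> = (\<Sum>a'\<in>Poly_Mapping.keys f. if a' = a then \<Sum>b'\<in>Poly_Mapping.keys g. if b' = b then Poly_Mapping.lookup f a' * Poly_Mapping.lookup g b' else 0 else 0)"
    by (intro sum.cong refl) auto
  also have "\<dots> = Poly_Mapping.lookup f a * Poly_Mapping.lookup g b"
    by (auto simp: sum.delta in_keys_iff)
  finally show ?thesis .
qed

lemma mult_map_superset:
  assumes "finite A" "Poly_Mapping.keys T \<subseteq> A"
  shows "mult_map T = (\<Sum>(a, b)\<in>A. Poly_Mapping.single (a + b) (Poly_Mapping.lookup T (a, b)))"
  unfolding mult_map_def using assms
  by (intro sum.mono_neutral_left) (auto simp: in_keys_iff)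

lemma linear_mult_map: "Vector_Spaces.linear pm_scale pm_scale (mult_map :: _ \<Rightarrow> 'k::field poly3)"
proof -
  have add: "mult_map (T + U) = mult_map T + mult_map U" for T U :: "mon3 \<times> mon3 \<Rightarrow>\<^sub>0 'k"
  proof -
    let ?A = "Poly_Mapping.keys T \<union> Poly_Mapping.keys U"
    have "mult_map (T + U) = (\<Sum>(a, b)\<in>?A. Poly_Mapping.single (a + b) (Poly_Mapping.lookup (T + U) (a, b)))"
      by (rule mult_map_superset) (auto simp: in_keys_iff lookup_add)
    also have "\<dots> = mult_map T + mult_map U"
      by (simp add: mult_map_superset[of ?A] lookup_add single_add sum.distrib case_prod_unfold)
    finally show ?thesis .
  qed
  have scale: "mult_map (pm_scale c T) = pm_scale c (mult_map T)" for c and T :: "mon3 \<times> mon3 \<Rightarrow>\<^sub>0 'k"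
  proof -
    have "mult_map (pm_scale c T) = (\<Sum>(a, b)\<in>Poly_Mapping.keys T. Poly_Mapping.single (a + b) (Poly_Mapping.lookup (pm_scale c T) (a, b)))"
      by (rule mult_map_superset) (auto simp: in_keys_iff)
    also have "\<dots> = (\<Sum>(a, b)\<in>Poly_Mapping.keys T. pm_scale c (Poly_Mapping.single (a + b) (Poly_Mapping.lookup T (a, b))))"
      by (intro sum.cong refl) (auto intro!: poly_mapping_eqI simp: lookup_single when_def)
    also have "\<dots> = pm_scale c (mult_map T)"
      by (simp add: mult_map_def pm.scale_sum_right case_prod_unfold)
    finally show ?thesis .
  qed
  show ?thesis
    by (auto simp: Vector_Spaces.linear_def module_hom_def module_hom_axioms_def
        pm.module_axioms pm.vector_space_axioms add scale)
qed

lemma mult_map_pure_tensor: "mult_map (pure_tensor f g) = f * g"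
proof -
  have decomp: "h = (\<Sum>a\<in>Poly_Mapping.keys h. Poly_Mapping.single a (Poly_Mapping.lookup h a))" for h :: "'a poly3"
    by (rule poly_mapping_eqI) (auto simp: lookup_sum lookup_single when_def sum.delta in_keys_iff)
  have "mult_map (pure_tensor f g) =
      (\<Sum>(a, b)\<in>Poly_Mapping.keys f \<times> Poly_Mapping.keys g. Poly_Mapping.single (a + b) (Poly_Mapping.lookup f a * Poly_Mapping.lookup g b))"
    by (subst mult_map_superset[of "Poly_Mapping.keys f \<times> Poly_Mapping.keys g"])
      (auto simp: lookup_pure_tensor in_keys_iff)
  also have "\<dots> = (\<Sum>a\<in>Poly_Mapping.keys f. \<Sum>b\<in>Poly_Mapping.keys g. Poly_Mapping.single a (Poly_Mapping.lookup f a) * Poly_Mapping.single b (Poly_Mapping.lookup g b))"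
    by (simp add: sum.cartesian_product mult_single)
  also have "\<dots> = f * g"
    by (subst (3) decomp[of f], subst (3) decomp[of g]) (simp add: sum_product)
  finally show ?thesis .
qed

lemma pure_tensor_add_left: "pure_tensor (f + f') g = pure_tensor f g + pure_tensor f' g"
  by (rule poly_mapping_eqI) (auto simp: lookup_pure_tensor lookup_add algebra_simps)

lemma pure_tensor_add_right: "pure_tensor f (g + g') = pure_tensor f g + pure_tensor f g'"
  by (rule poly_mapping_eqI) (auto simp: lookup_pure_tensor lookup_add algebra_simps)

lemma pure_tensor_scale_left: "pure_tensor (pm_scale c f) g = pm_scale c (pure_tensor f g)"
  by (rule poly_mapping_eqI) (auto simp: lookup_pure_tensor)

lemma pure_tensor_scale_right: "pure_tensor f (pm_scale c g) = pm_scale c (pure_tensor f g)"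
  by (rule poly_mapping_eqI) (auto simp: lookup_pure_tensor)

lemma pure_tensors_of_bases:
  assumes B: "finite B" "pm.independent B" and C: "finite C" "pm.independent C"
    and zero: "(\<Sum>b\<in>B. \<Sum>c\<in>C. pm_scale (r b c) (pure_tensor b c)) = 0"
    and bc: "b \<in> B" "c \<in> C"
  shows "r b c = 0"
proof -
  have "(\<Sum>c\<in>C. r b c * Poly_Mapping.lookup c y) = 0" for y
  proof -
    have "(\<Sum>b\<in>B. pm_scale (\<Sum>c\<in>C. r b c * Poly_Mapping.lookup c y) b) = 0"
    proof (rule poly_mapping_eqI)
      fix x
      have "Poly_Mapping.lookup (\<Sum>b\<in>B. \<Sum>c\<in>C. pm_scale (r b c) (pure_tensor b c)) (x, y) = 0"
        by (simp add: zero)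
      then have "(\<Sum>b\<in>B. \<Sum>c\<in>C. r b c * Poly_Mapping.lookup c y * Poly_Mapping.lookup b x) = 0"
        by (simp add: lookup_sum lookup_pure_tensor mult_ac)
      then show "Poly_Mapping.lookup (\<Sum>b\<in>B. pm_scale (\<Sum>c\<in>C. r b c * Poly_Mapping.lookup c y) b) x = Poly_Mapping.lookup 0 x"
        by (simp add: lookup_sum flip: sum_distrib_right)
    qed
    then show ?thesis
      by (rule pm.independentD[OF B(2,1) order_refl _ bc(1)])
  qed
  then have "(\<Sum>c\<in>C. pm_scale (r b c) c) = 0"
    by (intro poly_mapping_eqI) (simp add: lookup_sum)
  then show ?thesis
    by (rule pm.independentD[OF C(2,1) order_refl _ bc(2)])
qed

lemma dim_tensor_space:
  assumes U: "finite B0" "U \<subseteq> pm.span B0" and V: "finite C0" "V \<subseteq> pm.span C0"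
  shows "pm.dim (tensor_space U V) = pm.dim U * pm.dim V"
proof -
  obtain B where B: "B \<subseteq> U" "pm.independent B" "U \<subseteq> pm.span B" "card B = pm.dim U"
    by (rule pm.basis_exists)
  obtain C where C: "C \<subseteq> V" "pm.independent C" "V \<subseteq> pm.span C" "card C = pm.dim V"
    by (rule pm.basis_exists)
  have fB: "finite B" using pm.independent_span_bound[OF U(1) B(2)] B(1) U(2) by blast
  have fC: "finite C" using pm.independent_span_bound[OF V(1) C(2)] C(1) V(2) by blast
  let ?t = "\<lambda>(b, c). pure_tensor b c"
  let ?T = "?t ` (B \<times> C)"
  have zero: "\<forall>x\<in>B \<times> C. r x = 0" if "(\<Sum>x\<in>B \<times> C. pm_scale (r x) (?t x)) = 0" for r
    using pure_tensors_of_bases[OF fB B(2) fC C(2), of "\<lambda>b c. r (b, c)"] that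
    by (auto simp: sum.cartesian_product case_prod_unfold)
  have inj: "inj_on ?t (B \<times> C)"
  proof (rule inj_onI, rule ccontr)
    fix x y assume xy: "x \<in> B \<times> C" "y \<in> B \<times> C" "?t x = ?t y" "x \<noteq> y"
    let ?r = "\<lambda>z. if z = x then 1 else if z = y then - 1 else 0 :: 'a"
    have "(\<Sum>z\<in>B \<times> C. pm_scale (?r z) (?t z)) = (\<Sum>z\<in>{x, y}. pm_scale (?r z) (?t z))"
      using xy fB fC by (intro sum.mono_neutral_right) auto
    also have "\<dots> = 0"
      using xy(3,4) by simp
    finally have "?r x = 0" using zero[of ?r] xy(1) by blast
    then show False by simp
  qed
  have ind: "pm.independent ?T"
  proof (rule pm.independent_if_scalars_zero)
    show "finite ?T" using fB fC by simp
    fix f x assume s: "(\<Sum>x\<in>?T. pm_scale (f x) x) = 0" and x: "x \<in> ?T"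
    from s have "(\<Sum>x\<in>B \<times> C. pm_scale (f (?t x)) (?t x)) = 0"
      by (simp add: sum.reindex[OF inj])
    from zero[OF this] x show "f x = 0" by blast
  qed
  have right: "pure_tensor b g \<in> pm.span ?T" if b: "b \<in> B" and g: "g \<in> pm.span C" for b g
    using g
  proof (induction rule: pm.span_induct_alt)
    case base
    have "pure_tensor b 0 = 0" by (simp add: pure_tensor_def)
    then show ?case by (simp add: pm.span_zero)
  next
    case (step c x y)
    then show ?case using b
      unfolding pure_tensor_add_right pure_tensor_scale_right
      by (intro pm.span_add pm.span_scale pm.span_base[of "pure_tensor b x"]) auto
  qed
  have left: "pure_tensor f g \<in> pm.span ?T" if f: "f \<in> pm.span B" and g: "g \<in> pm.span C" for f g
    using f
  proof (induction rule: pm.span_induct_alt)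
    case base
    have "pure_tensor 0 g = 0" by (simp add: pure_tensor_def)
    then show ?case by (simp add: pm.span_zero)
  next
    case (step c x y)
    then show ?case using right[OF _ g]
      by (auto simp: pure_tensor_add_left pure_tensor_scale_left intro!: pm.span_add pm.span_scale)
  qed
  have "tensor_space U V = pm.span ?T"
    unfolding tensor_space_def
  proof (rule pm.span_eq[THEN iffD2], intro conjI)
    show "{pure_tensor f g |f g. f \<in> U \<and> g \<in> V} \<subseteq> pm.span ?T"
      using left B(3) C(3) by blast
    show "?T \<subseteq> pm.span {pure_tensor f g |f g. f \<in> U \<and> g \<in> V}"
      using B(1) C(1) by (intro subsetI pm.span_base) auto
  qed
  then have "pm.dim (tensor_space U V) = card ?T"
    using pm.dim_eq_card_independent[OF ind] by (simp add: pm.dim_span)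
  also have "\<dots> = pm.dim U * pm.dim V"
    using inj B(4) C(4) by (simp add: card_image card_cartesian_product)
  finally show ?thesis .
qed

end

(*
  Let s0 be the least degree with h_X(s0) >= m. Discard from X points not separated by forms of
  degree s0 until the remaining set Y imposes independent conditions in that degree; the ideal in
  degrees up to s0 does not change. Then remove points from Y one at a time, always a point p that
  is not separated in degree s0 - 1, until m points are left. This gives the Hilbert function of Z
  and the ranks in degrees other than s0: below s0 nothing changes, and above s0 the map
  mu is surjective for Z (Castelnuovo-Mumford).

  In degree s0 one needs that p can be chosen so that the rank of mu grows by 3 or mu becomes
  surjective. If W is the current set and T the image of mu, then I(W)/T in degree s0 + 1 is spanned
  by the forms (y - y_p L) F_p and (z - z_p L) F_p, with F_p a separator of p. If for every p these
  two were dependent modulo T, a Bezoutian identity would show that any two functionals on I(W)/T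
  are proportional, so T would have codimension at most 1, a case in which the removal of a suitable
  p makes mu surjective.
*)

theory Submission
  imports Defs "HOL-Analysis.Cartesian_Space"
begin

text \<open>The second entry of the minimum in (2) is an upper bound because
  \<open>dim S_1 = 3\<close>: a new form in degree \<open>s\<close> adds at most its products with
  three linear forms. Removal of \<open>p\<close> adds \<open>F_p\<close>, and \<open>L F_p\<close>
  is always new since it does not vanish at \<open>p\<close>; the gain is 3 exactly when the two
  other products are independent modulo \<open>T\<close>. At a single point this can fail, so the
  argument has to involve all points of \<open>W\<close> together. A functional on
  \<open>I(W)/T\<close> is therefore turned into two weights at each point, its values on
  \<open>(y - y_p L) F_p\<close> and \<open>(z - z_p L) F_p\<close>. The moments of these weights
  vanish below degree \<open>s0\<close>, and those of degree \<open>s0\<close> determine the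
  functional. Dependence at every \<open>p\<close> makes the determinant of the weights of two
  functionals vanish at each point, which is what the diagonal needs in a pairing over
  \<open>W \<times> W\<close>; off the diagonal the Bezoutian vanishes. The choice of
  \<open>p\<close> for the rank does not conflict with the Hilbert function: if one of the two
  products at \<open>p\<close> lies outside \<open>T\<close>, then \<open>p\<close> is not separated
  in degree \<open>s0 - 1\<close>.\<close>

section \<open>Divided differences and the Bezoutian\<close>

text \<open>The coordinates are changed one at a time, through the intermediate value
  \<open>y' ^ i * z ^ j\<close>.\<close>

lemma monomial_divided_difference:
  fixes y z y' z' :: "'k::field"
  shows "y ^ i * z ^ j - y' ^ i * z' ^ j =
    (\<Sum>l<i. y ^ l * y' ^ (i - Suc l)) * z ^ j * (y - y') +
    (\<Sum>l<j. z ^ l * z' ^ (j - Suc l)) * y' ^ i * (z - z')"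
proof -
  have *: "(\<Sum>l<n. u ^ l * v ^ (n - Suc l)) * (u - v) = u ^ n - v ^ n" for u v :: 'k and n
    by (simp add: power_diff_sumr2 mult_ac)
  have 1: "(\<Sum>l<i. y ^ l * y' ^ (i - Suc l)) * z ^ j * (y - y') = (y ^ i - y' ^ i) * z ^ j"
    by (simp flip: * add: mult_ac)
  have 2: "(\<Sum>l<j. z ^ l * z' ^ (j - Suc l)) * y' ^ i * (z - z') = (z ^ j - z' ^ j) * y' ^ i"
    by (simp flip: * add: mult_ac)
  show ?thesis unfolding 1 2 by (simp add: algebra_simps)
qed

text \<open>On \<open>P\<close> the forms \<open>y\<^sup>n z\<^bsup>s+1-n\<^esup>\<close> and \<open>y\<^bsup>n'\<^esup> z\<^bsup>s+1-n'\<^esup>\<close> agree with polynomials of degree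
  at most \<open>s\<close>; let \<open>f\<close> and \<open>g\<close> be the differences. The Bezoutian of \<open>f\<close> and \<open>g\<close>, a determinant of
  divided differences, vanishes at all pairs of distinct points of \<open>P\<close>. Pairing it with
  \<open>a\<^sub>1 \<otimes> b\<^sub>2 - b\<^sub>1 \<otimes> a\<^sub>2\<close>, which vanishes on the diagonal, therefore gives \<open>0\<close>. Only its component
  of bidegree \<open>(s, s)\<close> contributes to the pairing, and the corresponding sum telescopes.\<close>

lemma bezoutian_identity:
  fixes y z a1 a2 b1 b2 :: "'p \<Rightarrow> 'k::field" and \<phi>1 \<phi>2 :: "nat \<Rightarrow> 'k"
  assumes fin: "finite P"
    and inj: "\<And>p q. p \<in> P \<Longrightarrow> q \<in> P \<Longrightarrow> y p = y q \<Longrightarrow> z p = z q \<Longrightarrow> p = q"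
    and a1_low: "\<And>i j. i + j < s \<Longrightarrow> (\<Sum>p\<in>P. a1 p * (y p ^ i * z p ^ j)) = 0"
    and a2_low: "\<And>i j. i + j < s \<Longrightarrow> (\<Sum>p\<in>P. a2 p * (y p ^ i * z p ^ j)) = 0"
    and b1_low: "\<And>i j. i + j < s \<Longrightarrow> (\<Sum>p\<in>P. b1 p * (y p ^ i * z p ^ j)) = 0"
    and b2_low: "\<And>i j. i + j < s \<Longrightarrow> (\<Sum>p\<in>P. b2 p * (y p ^ i * z p ^ j)) = 0"
    and a1_top: "\<And>i j. i + j = s \<Longrightarrow> (\<Sum>p\<in>P. a1 p * (y p ^ i * z p ^ j)) = \<phi>1 (Suc i)"
    and a2_top: "\<And>i j. i + j = s \<Longrightarrow> (\<Sum>p\<in>P. a2 p * (y p ^ i * z p ^ j)) = \<phi>2 (Suc i)"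
    and b1_top: "\<And>i j. i + j = s \<Longrightarrow> (\<Sum>p\<in>P. b1 p * (y p ^ i * z p ^ j)) = \<phi>1 i"
    and b2_top: "\<And>i j. i + j = s \<Longrightarrow> (\<Sum>p\<in>P. b2 p * (y p ^ i * z p ^ j)) = \<phi>2 i"
    and det0: "\<And>p. p \<in> P \<Longrightarrow> a1 p * b2 p = b1 p * a2 p"
    and interp: "\<And>g. \<exists>c. \<forall>p\<in>P. g p = (\<Sum>(i, j)\<in>{(i, j). i + j \<le> s}. c (i, j) * (y p ^ i * z p ^ j))"
    and n: "n \<le> Suc s" and n': "n' \<le> Suc s"
  shows "\<phi>1 n * \<phi>2 n' = \<phi>1 n' * \<phi>2 n"
proof -
  define A where "A h = (\<Sum>p\<in>P. \<Sum>q\<in>P. (a1 p * b2 q - b1 p * a2 q) * h p q)" for h :: "'p \<Rightarrow> 'p \<Rightarrow> 'k"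
  \<comment> \<open>\<open>D1\<close> and \<open>D2\<close> are the divided differences of
    \<open>y^i z^j\<close> in the two directions, with the asymmetric order of
    \<open>monomial_divided_difference\<close>. \<open>E\<close> is the contribution of a pair of
    monomials to the pairing.\<close>
  define D1 where "D1 = (\<lambda>(i, j) p q. (\<Sum>l<i. y p ^ l * y q ^ (i - Suc l)) * z p ^ j)"
  define D2 where "D2 = (\<lambda>(i, j) p q. (\<Sum>l<j. z p ^ l * z q ^ (j - Suc l)) * y q ^ i)"
  define E where "E x x' = A (\<lambda>p q. D1 x p q * D2 x' p q)" for x x'
  have A_sum: "A (\<lambda>p q. \<Sum>x\<in>I. h x p q) = (\<Sum>x\<in>I. A (h x))" for I :: "'x set" and h
  proof -
    have "A (\<lambda>p q. \<Sum>x\<in>I. h x p q) = (\<Sum>p\<in>P. \<Sum>x\<in>I. \<Sum>q\<in>P. (a1 p * b2 q - b1 p * a2 q) * h x p q)"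
      unfolding A_def sum_distrib_left by (intro sum.cong refl sum.swap)
    also have "\<dots> = (\<Sum>x\<in>I. A (h x))"
      unfolding A_def by (rule sum.swap)
    finally show ?thesis .
  qed
  have A_scale: "A (\<lambda>p q. c * h p q) = c * A h" for c h
    unfolding A_def sum_distrib_left by (simp add: mult_ac)
  have A_diff: "A (\<lambda>p q. h p q - h' p q) = A h - A h'" for h h'
    unfolding A_def by (simp add: algebra_simps sum_subtractf sum.distrib)
  define m where "m i j k l = A (\<lambda>p q. (y p ^ i * z p ^ j) * (y q ^ k * z q ^ l))" for i j k l
  have m: "m i j k l = (\<Sum>p\<in>P. a1 p * (y p ^ i * z p ^ j)) * (\<Sum>p\<in>P. b2 p * (y p ^ k * z p ^ l))
      - (\<Sum>p\<in>P. b1 p * (y p ^ i * z p ^ j)) * (\<Sum>p\<in>P. a2 p * (y p ^ k * z p ^ l))" for i j k l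
    unfolding m_def A_def sum_product by (simp add: algebra_simps sum_subtractf sum.distrib)
  have m0: "m i j k l = 0" if "i + j < s \<or> k + l < s" for i j k l
    using that by (auto simp: m a1_low a2_low b1_low b2_low)
  have mtop: "m i j k l = \<phi>1 (Suc i) * \<phi>2 k - \<phi>1 i * \<phi>2 (Suc k)" if "i + j = s" "k + l = s" for i j k l
    using that by (simp add: m a1_top a2_top b1_top b2_top)
  have E: "E (i, j) (k, l) = (\<Sum>t<i. \<Sum>r<l. m t (j + r) (i - Suc t + k) (l - Suc r))" for i j k l
  proof -
    have "D1 (i, j) p q * D2 (k, l) p q =
      (\<Sum>t<i. \<Sum>r<l. (y p ^ t * z p ^ (j + r)) * (y q ^ (i - Suc t + k) * z q ^ (l - Suc r)))" for p q
    proof -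
      have "D1 (i, j) p q * D2 (k, l) p q = ((\<Sum>t<i. y p ^ t * y q ^ (i - Suc t)) * (\<Sum>r<l. z p ^ r * z q ^ (l - Suc r))) * (z p ^ j * y q ^ k)"
        by (simp add: D1_def D2_def mult_ac)
      also have "\<dots> = (\<Sum>t<i. \<Sum>r<l. (y p ^ t * y q ^ (i - Suc t)) * (z p ^ r * z q ^ (l - Suc r)) * (z p ^ j * y q ^ k))"
        unfolding sum_product unfolding sum_distrib_right ..
      also have "\<dots> = (\<Sum>t<i. \<Sum>r<l. (y p ^ t * z p ^ (j + r)) * (y q ^ (i - Suc t + k) * z q ^ (l - Suc r)))"
        by (intro sum.cong refl) (simp only: power_add mult_ac)
      finally show ?thesis .
    qed
    then show ?thesis unfolding E_def m_def by (simp only: A_sum)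
  qed
  \<comment> \<open>The two monomials in each term of \<open>E\<close> have total degree
    \<open>i + j + k + l - 2\<close>. If this is below \<open>2 * s\<close>, one of them has degree
    below \<open>s\<close>, and its moments vanish.\<close>
  have E0: "E (i, j) (k, l) = 0" if "i + j + k + l < 2 * s + 2" for i j k l
    unfolding E using that by (intro sum.neutral ballI m0) auto
  have Etop: "E (i, j) (k, l) = \<phi>1 i * \<phi>2 k - \<phi>1 (i - l) * \<phi>2 (i + k - (i - l))"
    if ij: "i + j = Suc s" and kl: "k + l = Suc s" for i j k l
  proof -
    have "(\<Sum>r<l. m t (j + r) (i - Suc t + k) (l - Suc r)) =
       (if i - l \<le> t then \<phi>1 (Suc t) * \<phi>2 (i + k - Suc t) - \<phi>1 t * \<phi>2 (i + k - t) else 0)" if t: "t < i" for t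
    proof -
      \<comment> \<open>In total degree \<open>2 * s\<close> only bidegree \<open>(s, s)\<close>
        survives. For given \<open>t\<close> this forces \<open>r = i - Suc t\<close>, which is in
        range exactly when \<open>i - l \<le> t\<close>.\<close>
      have "(\<Sum>r<l. m t (j + r) (i - Suc t + k) (l - Suc r)) =
        (\<Sum>r<l. if r = i - Suc t then m t (j + r) (i - Suc t + k) (l - Suc r) else 0)"
        by (intro sum.cong refl) (use t ij kl in \<open>auto intro!: m0\<close>)
      also have "\<dots> = (if i - Suc t < l then m t (j + (i - Suc t)) (i - Suc t + k) (l - Suc (i - Suc t)) else 0)"
        by (simp add: sum.delta)
      also have "\<dots> = (if i - l \<le> t then \<phi>1 (Suc t) * \<phi>2 (i + k - Suc t) - \<phi>1 t * \<phi>2 (i + k - t) else 0)"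
      proof (cases "i - l \<le> t")
        case True
        then have "i - Suc t < l" "t + (j + (i - Suc t)) = s" "i - Suc t + k + (l - Suc (i - Suc t)) = s"
          using t ij kl by auto
        moreover have "i - Suc t + k = i + k - Suc t" "Suc (i + k - Suc t) = i + k - t" using t by auto
        ultimately show ?thesis using True by (simp add: mtop del: add_Suc_right)
      next
        case False
        then have "\<not> i - Suc t < l" using t by auto
        then show ?thesis using False by simp
      qed
      finally show ?thesis .
    qed
    then have "E (i, j) (k, l) = (\<Sum>t<i. if i - l \<le> t then \<phi>1 (Suc t) * \<phi>2 (i + k - Suc t) - \<phi>1 t * \<phi>2 (i + k - t) else 0)"
      unfolding E by simp
    also have "\<dots> = (\<Sum>t\<in>{i - l..<i}. \<phi>1 (Suc t) * \<phi>2 (i + k - Suc t) - \<phi>1 t * \<phi>2 (i + k - t))"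
      by (rule sum.mono_neutral_cong_right) auto
    also have "\<dots> = \<phi>1 i * \<phi>2 k - \<phi>1 (i - l) * \<phi>2 (i + k - (i - l))"
      by (subst sum_Suc_diff'[where f = "\<lambda>t. \<phi>1 t * \<phi>2 (i + k - t)"]) auto
    finally show ?thesis .
  qed
  define I where "I = {(i, j). i + j \<le> Suc s}"
  have finI: "finite I"
    by (rule finite_subset[of _ "{..Suc s} \<times> {..Suc s}"]) (auto simp: I_def)
  \<comment> \<open>By interpolation some polynomial vanishes on \<open>P\<close> and has the single
    monomial \<open>y^n z^(s+1-n)\<close> as its part of degree \<open>s + 1\<close>.\<close>
  have rel: "\<exists>F. (\<forall>i j. i + j = Suc s \<longrightarrow> F (i, j) = (if i = n then 1 else 0)) \<and>
      (\<forall>p\<in>P. (\<Sum>(i, j)\<in>I. F (i, j) * (y p ^ i * z p ^ j)) = 0)" if n: "n \<le> Suc s" for n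
  proof -
    obtain c where c: "\<And>p. p \<in> P \<Longrightarrow> y p ^ n * z p ^ (Suc s - n) = (\<Sum>(i, j)\<in>{(i, j). i + j \<le> s}. c (i, j) * (y p ^ i * z p ^ j))"
      using interp[of "\<lambda>p. y p ^ n * z p ^ (Suc s - n)"] by blast
    define F where "F = (\<lambda>(i, j). if i + j = Suc s then (if i = n then 1 else 0) else - c (i, j))"
    have "(\<Sum>(i, j)\<in>I. F (i, j) * (y p ^ i * z p ^ j)) = 0" if p: "p \<in> P" for p
    proof -
      let ?g = "\<lambda>(i, j). F (i, j) * (y p ^ i * z p ^ j)"
      have "sum ?g I = sum ?g {(i, j). i + j \<le> s} + sum ?g (I - {(i, j). i + j \<le> s})"
        by (subst sum.subset_diff[OF _ finI, of "{(i, j). i + j \<le> s}"]) (auto simp: I_def add.commute)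
      also have "sum ?g (I - {(i, j). i + j \<le> s}) = sum ?g {(n, Suc s - n)}"
        by (rule sum.mono_neutral_right) (use finI n in \<open>auto simp: I_def F_def split: if_splits\<close>)
      also have "\<dots> = y p ^ n * z p ^ (Suc s - n)" using n by (simp add: F_def)
      also have "sum ?g {(i, j). i + j \<le> s} = - (\<Sum>(i, j)\<in>{(i, j). i + j \<le> s}. c (i, j) * (y p ^ i * z p ^ j))"
        unfolding sum_negf[symmetric] by (rule sum.cong) (auto simp: F_def)
      finally show ?thesis using c[OF p] by simp
    qed
    then show ?thesis by (intro exI[of _ F]) (auto simp: F_def)
  qed
  obtain F where Ft: "\<And>i j. i + j = Suc s \<Longrightarrow> F (i, j) = (if i = n then 1 else 0)"
    and F: "\<And>p. p \<in> P \<Longrightarrow> (\<Sum>(i, j)\<in>I. F (i, j) * (y p ^ i * z p ^ j)) = 0"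
    using rel[OF n] by blast
  obtain G where Gt: "\<And>i j. i + j = Suc s \<Longrightarrow> G (i, j) = (if i = n' then 1 else 0)"
    and G: "\<And>p. p \<in> P \<Longrightarrow> (\<Sum>(i, j)\<in>I. G (i, j) * (y p ^ i * z p ^ j)) = 0"
    using rel[OF n'] by blast
  define d1 where "d1 F p q = (\<Sum>x\<in>I. F x * D1 x p q)" for F p q
  define d2 where "d2 F p q = (\<Sum>x\<in>I. F x * D2 x p q)" for F p q
  have dd: "d1 F p q * (y p - y q) + d2 F p q * (z p - z q) = 0"
    if F: "\<And>p. p \<in> P \<Longrightarrow> (\<Sum>(i, j)\<in>I. F (i, j) * (y p ^ i * z p ^ j)) = 0" and pq: "p \<in> P" "q \<in> P" for F p q
  proof -
    have D: "D1 (i, j) p q * (y p - y q) + D2 (i, j) p q * (z p - z q) = y p ^ i * z p ^ j - y q ^ i * z q ^ j" for i j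
      unfolding D1_def D2_def using monomial_divided_difference[of "y p" i "z p" j "y q" "z q"] by simp
    have "d1 F p q * (y p - y q) + d2 F p q * (z p - z q) =
        (\<Sum>x\<in>I. F x * (D1 x p q * (y p - y q) + D2 x p q * (z p - z q)))"
      unfolding d1_def d2_def sum_distrib_right sum.distrib[symmetric] by (simp add: algebra_simps)
    also have "\<dots> = (\<Sum>(i, j)\<in>I. F (i, j) * (y p ^ i * z p ^ j) - F (i, j) * (y q ^ i * z q ^ j))"
      by (intro sum.cong refl) (clarsimp simp only: D prod.case, rule right_diff_distrib)
    also have "\<dots> = 0" using F[OF pq(1)] F[OF pq(2)] by (simp add: case_prod_unfold sum_subtractf)
    finally show ?thesis .
  qed
  have "A (\<lambda>p q. d1 F p q * d2 G p q - d1 G p q * d2 F p q) = 0"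
    unfolding A_def
  proof (intro sum.neutral ballI)
    fix p q assume pq: "p \<in> P" "q \<in> P"
    show "(a1 p * b2 q - b1 p * a2 q) * (d1 F p q * d2 G p q - d1 G p q * d2 F p q) = 0"
    proof (cases "p = q")
      case True then show ?thesis using det0[OF pq(1)] by simp
    next
      case False
      \<comment> \<open>Off the diagonal the divided differences of \<open>F\<close> and of
        \<open>G\<close> both annihilate the nonzero vector \<open>(u, v)\<close>, so their
        determinant is zero.\<close>
      define u v where "u = y p - y q" and "v = z p - z q"
      have uv: "u \<noteq> 0 \<or> v \<noteq> 0" using inj[OF pq] False by (auto simp: u_def v_def)
      have "d1 F p q * u + d2 F p q * v = 0" "d1 G p q * u + d2 G p q * v = 0"
        using dd[OF F pq] dd[OF G pq] by (simp_all add: u_def v_def)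
      moreover have "(d1 F p q * d2 G p q - d1 G p q * d2 F p q) * u =
          (d1 F p q * u + d2 F p q * v) * d2 G p q - (d1 G p q * u + d2 G p q * v) * d2 F p q"
        "(d1 F p q * d2 G p q - d1 G p q * d2 F p q) * v =
          d1 F p q * (d1 G p q * u + d2 G p q * v) - d1 G p q * (d1 F p q * u + d2 F p q * v)"
        by (simp_all add: algebra_simps)
      ultimately have "(d1 F p q * d2 G p q - d1 G p q * d2 F p q) * u = 0"
        "(d1 F p q * d2 G p q - d1 G p q * d2 F p q) * v = 0"
        by simp_all
      then show ?thesis using uv by auto
    qed
  qed
  moreover have "A (\<lambda>p q. d1 F p q * d2 G p q) = E (k, Suc s - k) (k', Suc s - k')"
    if Ft: "\<And>i j. i + j = Suc s \<Longrightarrow> F (i, j) = (if i = k then 1 else 0)"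
    and Gt: "\<And>i j. i + j = Suc s \<Longrightarrow> G (i, j) = (if i = k' then 1 else 0)"
    and k: "k \<le> Suc s" and k': "k' \<le> Suc s" for F G k k'
  proof -
    \<comment> \<open>By \<open>E0\<close> every pair of monomials drops out unless both have degree
      \<open>s + 1\<close>, and each of the two polynomials has only one such monomial.\<close>
    have "A (\<lambda>p q. d1 F p q * d2 G p q) = A (\<lambda>p q. \<Sum>x\<in>I. \<Sum>x'\<in>I. F x * (G x' * (D1 x p q * D2 x' p q)))"
      unfolding d1_def d2_def sum_product by (simp add: mult_ac)
    also have "\<dots> = (\<Sum>x\<in>I. \<Sum>x'\<in>I. F x * (G x' * E x x'))"
      by (simp only: A_sum A_scale E_def)
    also have "\<dots> = (\<Sum>x\<in>I. \<Sum>x'\<in>I. if x' = (k', Suc s - k') then if x = (k, Suc s - k) then E x x' else 0 else 0)"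
    proof (intro sum.cong refl)
      fix x x' assume I: "x \<in> I" "x' \<in> I"
      obtain i j i' j' where x: "x = (i, j)" "x' = (i', j')" by fastforce
      show "F x * (G x' * E x x') = (if x' = (k', Suc s - k') then if x = (k, Suc s - k) then E x x' else 0 else 0)"
      proof (cases "i + j = Suc s \<and> i' + j' = Suc s")
        case True
        then show ?thesis using k k' by (auto simp: x Ft Gt)
      next
        case False
        then have "E x x' = 0" using I unfolding x I_def by (intro E0) auto
        then show ?thesis by auto
      qed
    qed
    also have "\<dots> = E (k, Suc s - k) (k', Suc s - k')"
      using finI k k' by (simp add: sum.delta I_def)
    finally show ?thesis .
  qed
  note EE = this
  have "A (\<lambda>p q. d1 F p q * d2 G p q - d1 G p q * d2 F p q) = E (n, Suc s - n) (n', Suc s - n') - E (n', Suc s - n') (n, Suc s - n)"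
    unfolding A_diff using EE[OF Ft Gt n n'] EE[OF Gt Ft n' n] by simp
  ultimately have "E (n, Suc s - n) (n', Suc s - n') = E (n', Suc s - n') (n, Suc s - n)" by simp
  \<comment> \<open>Both sides are the truncated \<open>n + n' - Suc s\<close>. Hence the lower
    boundary terms of the two telescoping sums agree and cancel.\<close>
  moreover have "n - (Suc s - n') = n' - (Suc s - n)" using n n' by auto
  ultimately show ?thesis using n n' by (simp add: Etop add.commute)
qed

section \<open>Linear algebra of finite-dimensional subspaces\<close>

lemma vector_space_mult: "vector_space ((*) :: 'k::field \<Rightarrow> 'k \<Rightarrow> 'k)"
  by unfold_locales (auto simp: algebra_simps)

context vector_space
begin

lemma span_insert_eq:
  assumes "subspace U"
  shows "span (insert x U) = {u + scale c x |u c. u \<in> U}"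
proof -
  have "y \<in> span (insert x U) \<longleftrightarrow> (\<exists>c. y - scale c x \<in> U)" for y
    by (simp add: span_breakdown_eq span_eq_iff[THEN iffD2, OF assms])
  moreover have "(\<exists>c. y - scale c x \<in> U) \<longleftrightarrow> (\<exists>u c. y = u + scale c x \<and> u \<in> U)" for y
    by (metis add_diff_cancel_right' diff_add_cancel)
  ultimately show ?thesis by auto
qed

lemma exists_basis_of_subspace:
  assumes "subspace U"
  obtains B where "independent B" "span B = U"
  by (metis assms maximal_independent_subset span_minimal subset_antisym)

lemma separating_functional:
  assumes U: "subspace U" and x: "x \<notin> U"
  shows "\<exists>\<phi>. Vector_Spaces.linear scale (*) \<phi> \<and> (\<forall>u\<in>U. \<phi> u = 0) \<and> \<phi> x = 1"
proof -
  interpret p: vector_space_pair scale "(*) :: 'a \<Rightarrow> 'a \<Rightarrow> 'a"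
    using vector_space_axioms vector_space_mult by (simp add: vector_space_pair_def)
  obtain B where B: "independent B" "span B = U"
    using exists_basis_of_subspace[OF U] .
  have iB: "independent (insert x B)"
    using independent_insertI[OF _ B(1)] x B(2) by simp
  define \<phi> where "\<phi> = p.construct (insert x B) (\<lambda>b. if b = x then 1 else 0)"
  have lin: "Vector_Spaces.linear scale (*) \<phi>"
    unfolding \<phi>_def by (rule p.linear_construct[OF iB])
  interpret l: Vector_Spaces.linear scale "(*)" \<phi> by (rule lin)
  have "\<phi> b = 0" if "b \<in> B" for b
  proof -
    have "b \<noteq> x" using that B(2) x span_base by blast
    then show ?thesis using that unfolding \<phi>_def by (subst p.construct_basis[OF iB]) auto
  qed
  then have "\<phi> u = 0" if "u \<in> U" for u
    using l.eq_0_on_span[of B u] that B(2) by blast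
  moreover have "\<phi> x = 1" unfolding \<phi>_def by (subst p.construct_basis[OF iB]) auto
  ultimately show ?thesis using lin by blast
qed

text \<open>The library's dimension theory assumes a finite-dimensional ambient space; here only the
  subspace is finite-dimensional.\<close>

lemma dim_mono_finite:
  assumes "V \<subseteq> span W" "W \<subseteq> span B" "finite B"
  shows "dim V \<le> dim W"
proof -
  obtain C where C: "C \<subseteq> W" "independent C" "W \<subseteq> span C" "card C = dim W"
    by (rule basis_exists)
  have "finite C" using independent_span_bound[OF assms(3) C(2)] C(1) assms(2) by blast
  moreover have "V \<subseteq> span C" using assms(1) span_minimal[OF C(3) subspace_span] by blast
  ultimately show ?thesis using dim_le_card[of V C] C(4) by simp
qed

lemma dim_span_insert:
  assumes "subspace U" "U \<subseteq> span B" "finite B" "x \<notin> U"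
  shows "dim (span (insert x U)) = Suc (dim U)"
proof -
  obtain C where C: "C \<subseteq> U" "independent C" "U \<subseteq> span C" "card C = dim U"
    by (rule basis_exists)
  have fC: "finite C" using independent_span_bound[OF assms(3) C(2)] C(1) assms(2) by blast
  have UC: "span C = U" using C(1,3) span_minimal[OF C(1) assms(1)] by blast
  have x: "x \<notin> span C" using assms(4) UC by simp
  then have "independent (insert x C)" using C(2) independent_insertI by blast
  moreover have "span (insert x C) = span (insert x U)"
    using UC span_Un[of "{x}" C] span_Un[of "{x}" U] span_eq_iff[THEN iffD2, OF assms(1)] by simp
  moreover have "x \<notin> C" using x span_base by blast
  then have "card (insert x C) = Suc (dim U)" using fC C(4) by simp
  ultimately show ?thesis using dim_span_eq_card_independent[of "insert x C"] by simp
qed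

lemma dim_insert_le:
  assumes "U \<subseteq> span B" "finite B"
  shows "dim (insert x U) \<le> Suc (dim U)"
proof -
  obtain C where C: "C \<subseteq> U" "independent C" "U \<subseteq> span C" "card C = dim U"
    by (rule basis_exists)
  have fC: "finite C" using independent_span_bound[OF assms(2) C(2)] C(1) assms(1) by blast
  have "insert x U \<subseteq> span (insert x C)"
    using C(3) span_mono[of C "insert x C"] by (auto intro: span_base)
  then have "dim (insert x U) \<le> card (insert x C)"
    using fC by (intro dim_le_card) auto
  also have "\<dots> \<le> Suc (dim U)" using C(4) by (simp add: card_insert_le_m1 fC card_insert_if)
  finally show ?thesis .
qed

lemma subspace_eq_if_dim_le:
  assumes "subspace U" "U \<subseteq> V" "V \<subseteq> span B" "finite B" "dim V \<le> dim U"
  shows "U = V"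
proof (rule ccontr)
  assume "U \<noteq> V"
  then obtain x where x: "x \<in> V" "x \<notin> U" using assms(2) by blast
  have "dim (span (insert x U)) = Suc (dim U)"
    using assms x by (intro dim_span_insert) auto
  moreover have "dim (span (insert x U)) \<le> dim V"
    using assms x by (intro dim_mono_finite[of _ V B] span_mono) auto
  ultimately show False using assms(5) by simp
qed

end

section \<open>Evaluation and homogeneous polynomials\<close>

lemma poly3_decomp:
  fixes f :: "'k::field poly3"
  shows "f = (\<Sum>a\<in>Poly_Mapping.keys f. Poly_Mapping.single a (Poly_Mapping.lookup f a))"
  by (rule poly_mapping_eqI) (auto simp: lookup_sum lookup_single when_def sum.delta in_keys_iff)

lemma poly3_induct [case_names single add]:
  fixes f :: "'k::field poly3"
  assumes "\<And>a c. P (Poly_Mapping.single a c)" and "\<And>f g. P f \<Longrightarrow> P g \<Longrightarrow> P (f + g)"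
  shows "P f"
proof -
  have "P (\<Sum>a\<in>A. Poly_Mapping.single a (Poly_Mapping.lookup f a))" if "finite A" for A
    using that by induction (use assms(1)[of _ 0] assms in auto)
  then show ?thesis by (subst poly3_decomp) simp
qed

lemma eval3_superset:
  assumes "finite A" "Poly_Mapping.keys f \<subseteq> A"
  shows "eval3 f v = (\<Sum>a\<in>A. Poly_Mapping.lookup f a * (\<Prod>i\<in>UNIV. (v $ i) ^ Poly_Mapping.lookup a i))"
  unfolding eval3_def using assms by (intro sum.mono_neutral_left) (auto simp: in_keys_iff)

lemma eval3_add [simp]: "eval3 (f + g) v = eval3 f v + eval3 g v"
proof -
  let ?A = "Poly_Mapping.keys f \<union> Poly_Mapping.keys g"
  have "eval3 (f + g) v = (\<Sum>a\<in>?A. Poly_Mapping.lookup (f + g) a * (\<Prod>i\<in>UNIV. (v $ i) ^ Poly_Mapping.lookup a i))"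
    by (rule eval3_superset) (auto simp: in_keys_iff lookup_add)
  also have "\<dots> = eval3 f v + eval3 g v"
    by (simp add: eval3_superset[of ?A] lookup_add distrib_right sum.distrib)
  finally show ?thesis .
qed

lemma eval3_zero [simp]: "eval3 0 v = 0"
  by (simp add: eval3_def)

lemma eval3_single [simp]:
  "eval3 (Poly_Mapping.single a c) v = c * (\<Prod>i\<in>UNIV. (v $ i) ^ Poly_Mapping.lookup a i)"
  by (subst eval3_superset[of "{a}"]) auto

lemma eval3_mult [simp]: "eval3 (f * g) v = eval3 f v * eval3 g v"
proof (induction f rule: poly3_induct)
  case (single a c)
  show ?case
  proof (induction g rule: poly3_induct)
    case (single b d)
    then show ?case by (simp add: mult_single lookup_add power_add prod.distrib)
  qed (simp add: algebra_simps)
qed (simp add: algebra_simps)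

lemma eval3_scale [simp]: "eval3 (pm_scale c f) v = c * eval3 f v"
  unfolding eval3_superset[of "Poly_Mapping.keys f" f, OF finite_keys order_refl]
  by (subst eval3_superset[of "Poly_Mapping.keys f"]) (auto simp: in_keys_iff sum_distrib_left mult.assoc)

lemma eval3_diff [simp]: "eval3 (f - g) v = eval3 f v - eval3 g v"
  using eval3_add[of "f - g" g v] by simp

lemma eval3_sum: "eval3 (sum f A) v = (\<Sum>x\<in>A. eval3 (f x) v)"
  by (induction A rule: infinite_finite_induct) auto

lemma eval3_one [simp]: "eval3 1 v = 1"
  by (simp flip: single_one)

lemma eval3_power [simp]: "eval3 (f ^ n) v = eval3 f v ^ n"
  by (induction n) auto

lemma pm_scale_mult_left: "pm_scale c f * g = pm_scale c (f * g)" for f g :: "'k::field poly3"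
proof -
  have *: "pm_scale c h = Poly_Mapping.single 0 c * h" for h :: "'k poly3"
  proof (induction h rule: poly3_induct)
    case (single a d)
    then show ?case by (simp add: mult_single) (auto intro!: poly_mapping_eqI simp: lookup_single when_def)
  qed (simp add: pm.scale_right_distrib distrib_left)
  show ?thesis by (simp add: * mult.assoc)
qed

lemma pm_scale_mult_right: "f * pm_scale c g = pm_scale c (f * g)" for f g :: "'k::field poly3"
  using pm_scale_mult_left[of c g f] by (simp add: mult.commute)

lemma mdeg_add [simp]: "mdeg (a + b) = mdeg a + mdeg b"
  by (simp add: mdeg_def lookup_add sum.distrib)

lemma mdeg_zero [simp]: "mdeg 0 = 0"
  by (simp add: mdeg_def)

lemma mdeg_single [simp]: "mdeg (Poly_Mapping.single i n) = n"
  by (simp add: mdeg_def lookup_single when_def)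

lemma mdeg_eq_0_iff [simp]: "mdeg a = 0 \<longleftrightarrow> a = 0"
  by (auto simp: mdeg_def intro: poly_mapping_eqI)

lemma subspace_homog [simp]: "pm.subspace (homog t)"
proof (rule pm.subspaceI)
  fix f g :: "'a poly3" assume "f \<in> homog t" "g \<in> homog t"
  then show "f + g \<in> homog t"
    using Poly_Mapping.keys_add[of f g] by (auto simp: homog_def)
qed (auto simp: homog_def in_keys_iff)

lemma homog_add [intro]: "f \<in> homog t \<Longrightarrow> g \<in> homog t \<Longrightarrow> f + g \<in> homog t"
  by (rule pm.subspace_add[OF subspace_homog])

lemma homog_diff [intro]: "f \<in> homog t \<Longrightarrow> g \<in> homog t \<Longrightarrow> f - g \<in> homog t"
  by (rule pm.subspace_diff[OF subspace_homog])

lemma homog_scale [intro]: "f \<in> homog t \<Longrightarrow> pm_scale c f \<in> homog t"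
  by (rule pm.subspace_scale[OF subspace_homog])

lemma homog_sum: "(\<And>x. x \<in> A \<Longrightarrow> f x \<in> homog t) \<Longrightarrow> sum f A \<in> homog t"
  by (rule pm.subspace_sum[OF subspace_homog])

lemma homog_mult: "f \<in> homog s \<Longrightarrow> g \<in> homog t \<Longrightarrow> f * g \<in> homog (s + t)"
  using Poly_Mapping.keys_mult[of f g] by (fastforce simp: homog_def)

lemma homog_one [intro]: "1 \<in> homog 0"
  by (auto simp: homog_def simp flip: single_one)

lemma homog_power: "f \<in> homog s \<Longrightarrow> f ^ n \<in> homog (s * n)"
  by (induction n) (auto simp: homog_one homog_mult)

lemma eval3_homog_scaled:
  assumes "f \<in> homog t"
  shows "eval3 f (c *s v) = c ^ t * eval3 f v"
  unfolding eval3_def sum_distrib_left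
proof (intro sum.cong refl)
  fix a assume "a \<in> Poly_Mapping.keys f"
  then have "t = (\<Sum>i\<in>UNIV. Poly_Mapping.lookup a i)" using assms by (auto simp: homog_def mdeg_def)
  then have "(\<Prod>i\<in>UNIV. ((c *s v) $ i) ^ Poly_Mapping.lookup a i) = c ^ t * (\<Prod>i\<in>UNIV. (v $ i) ^ Poly_Mapping.lookup a i)"
    by (simp add: power_mult_distrib prod.distrib power_sum)
  then show "Poly_Mapping.lookup f a * (\<Prod>i\<in>UNIV. ((c *s v) $ i) ^ Poly_Mapping.lookup a i) =
      c ^ t * (Poly_Mapping.lookup f a * (\<Prod>i\<in>UNIV. (v $ i) ^ Poly_Mapping.lookup a i))"
    by simp
qed

definition var :: "3 \<Rightarrow> 'k::field poly3" where
  "var i = Poly_Mapping.single (Poly_Mapping.single i 1) 1"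

lemma three_eq_0: "(3 :: 3) = 0"
  by simp

lemma var_homog [simp, intro]: "var i \<in> homog (Suc 0)"
  by (auto simp: var_def homog_def)

lemma eval3_var [simp]: "eval3 (var i) v = v $ i"
proof -
  have "(\<Prod>j\<in>UNIV. (v $ j) ^ Poly_Mapping.lookup (Poly_Mapping.single i (1::nat)) j) = (\<Prod>j\<in>UNIV. if j = i then v $ i else 1)"
    by (intro prod.cong refl) (auto simp: lookup_single when_def)
  then show ?thesis by (simp add: var_def prod.delta)
qed

lemma homog_0: "homog 0 = range (\<lambda>c. pm_scale c (1 :: 'k::field poly3))"
proof (intro equalityI subsetI)
  fix f :: "'k poly3" assume "f \<in> homog 0"
  then have "f = pm_scale (Poly_Mapping.lookup f 0) 1"
    by (intro poly_mapping_eqI) (auto simp: homog_def in_keys_iff lookup_one when_def)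
  then show "f \<in> range (\<lambda>c. pm_scale c 1)" by blast
qed auto

text \<open>A monomial of positive degree contains some variable \<open>var j\<close>; the quotient
  by it is added to the coefficient \<open>g j\<close>.\<close>

lemma homog_Suc_decomp_vars:
  fixes f :: "'k::field poly3"
  assumes "f \<in> homog (Suc s)"
  shows "\<exists>g. (\<forall>i. g i \<in> homog s) \<and> f = (\<Sum>i\<in>UNIV. var i * g i)"
proof -
  have "\<exists>g. (\<forall>i. g i \<in> homog s) \<and> (\<Sum>a\<in>A. Poly_Mapping.single a (Poly_Mapping.lookup f a)) = (\<Sum>i\<in>UNIV. var i * g i)"
    if "finite A" "A \<subseteq> Poly_Mapping.keys f" for A
    using that
  proof induction
    case empty
    show ?case by (rule exI[of _ "\<lambda>_. 0"]) (simp add: homog_def)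
  next
    case (insert a A)
    then obtain g where g: "\<And>i. g i \<in> homog s"
      "(\<Sum>a\<in>A. Poly_Mapping.single a (Poly_Mapping.lookup f a)) = (\<Sum>i\<in>UNIV. var i * g i)" by auto
    have "mdeg a = Suc s" using insert assms by (auto simp: homog_def)
    then obtain j where j: "Poly_Mapping.lookup a j > 0"
      unfolding mdeg_def by (metis (no_types, lifting) gr0I sum.neutral nat.distinct(1))
    define b where "b = a - Poly_Mapping.single j 1"
    have a: "a = Poly_Mapping.single j 1 + b"
      by (rule poly_mapping_eqI) (use j in \<open>auto simp: b_def lookup_add lookup_minus lookup_single when_def\<close>)
    then have b: "mdeg b = s" using \<open>mdeg a = Suc s\<close> by simp
    define m where "m = Poly_Mapping.single b (Poly_Mapping.lookup f a)"
    have m: "m \<in> homog s" using b by (auto simp: m_def homog_def)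
    have "Poly_Mapping.single a (Poly_Mapping.lookup f a) = var j * m"
      by (subst a) (simp add: m_def var_def mult_single)
    then have "(\<Sum>a\<in>insert a A. Poly_Mapping.single a (Poly_Mapping.lookup f a)) = (\<Sum>i\<in>UNIV. var i * g i) + var j * m"
      using insert g by simp
    also have "\<dots> = (\<Sum>i\<in>UNIV. var i * (g(j := g j + m)) i)"
      by (simp add: sum.remove[of UNIV j] distrib_left add_ac)
    finally show ?case using g m by (intro exI[of _ "g(j := g j + m)"]) auto
  qed
  from this[of "Poly_Mapping.keys f"] show ?thesis by (simp flip: poly3_decomp)
qed

section \<open>Forms vanishing on a set of vectors, and their linear multiples\<close>

text \<open>\<open>P\<close> consists of coordinate vectors, later one representative for each
  projective point, so that a form has a value at a point and not just a zero or nonzero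
  status.\<close>

definition forms_vanishing :: "('k::field ^ 3) set \<Rightarrow> nat \<Rightarrow> 'k poly3 set" where
  "forms_vanishing P t = {f \<in> homog t. \<forall>p\<in>P. eval3 f p = 0}"

lemma subspace_forms_vanishing [simp]: "pm.subspace (forms_vanishing P t)"
  unfolding forms_vanishing_def
  by (rule pm.subspaceI)
    (auto intro: pm.subspace_0[OF subspace_homog])

lemma forms_vanishing_mult: "f \<in> homog s \<Longrightarrow> g \<in> forms_vanishing P t \<Longrightarrow> f * g \<in> forms_vanishing P (s + t)"
  by (auto simp: forms_vanishing_def homog_mult)

lemma forms_vanishing_antimono: "P \<subseteq> Q \<Longrightarrow> forms_vanishing Q t \<subseteq> forms_vanishing P t"
  by (auto simp: forms_vanishing_def)

text \<open>For \<open>U\<close> the degree \<open>s\<close> part of an ideal \<open>I(W)\<close>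
  this is the image of the multiplication map, and its dimension is the rank.\<close>

definition linear_multiples :: "'k::field poly3 set \<Rightarrow> 'k poly3 set" where
  "linear_multiples U = pm.span {l * f | l f. l \<in> homog 1 \<and> f \<in> U}"

lemma linear_multiplesI: "l \<in> homog 1 \<Longrightarrow> f \<in> U \<Longrightarrow> l * f \<in> linear_multiples U"
  unfolding linear_multiples_def by (rule pm.span_base) auto

lemma subspace_linear_multiples [simp]: "pm.subspace (linear_multiples U)"
  by (simp add: linear_multiples_def)

lemma linear_multiples_mono: "U \<subseteq> V \<Longrightarrow> linear_multiples U \<subseteq> linear_multiples V"
  unfolding linear_multiples_def by (intro pm.span_mono) auto

lemma linear_multiples_forms_vanishing:
  "linear_multiples (forms_vanishing P s) \<subseteq> forms_vanishing P (Suc s)"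
  unfolding linear_multiples_def
  by (rule pm.span_minimal) (use forms_vanishing_mult[of _ 1 _ P s] in auto)

section \<open>Affine charts\<close>

text \<open>All finite point sets below lie in the affine chart \<open>L \<noteq> 0\<close> of some \<open>L = x\<^sub>0 + c x\<^sub>1 + c\<^sup>2 x\<^sub>2\<close>,
  and each point is represented by its coordinate vector with \<open>L = 1\<close>. At a given point, \<open>L\<close> is a
  nonzero polynomial in \<open>c\<close>, so over an infinite field some \<open>c\<close> serves all points.\<close>

locale affine_chart =
  fixes c :: "'k::field"
begin

definition L :: "'k poly3" where
  "L = var 0 + pm_scale c (var 1) + pm_scale (c ^ 2) (var 2)"

abbreviation y :: "'k poly3" where "y \<equiv> var 1"
abbreviation z :: "'k poly3" where "z \<equiv> var 2"

definition chart :: "('k ^ 3) set" where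
  "chart = {v. v $ 0 + c * v $ 1 + c ^ 2 * v $ 2 = 1}"

lemma L_homog [simp, intro]: "L \<in> homog (Suc 0)"
  unfolding L_def by auto

lemma eval3_L: "v \<in> chart \<Longrightarrow> eval3 L v = 1"
  by (simp add: chart_def L_def)

lemma chart_eqI:
  assumes "u \<in> chart" "v \<in> chart" "u $ 1 = v $ 1" "u $ 2 = v $ 2"
  shows "u = v"
proof -
  have "u $ 0 = v $ 0" using assms by (simp add: chart_def) (metis add_right_cancel)
  then have "u $ i = v $ i" for i
    using assms(3,4) exhaust_3[of i] three_eq_0 by metis
  then show ?thesis by (simp add: vec_eq_iff)
qed

text \<open>\<open>L\<close> has coefficient 1 at \<open>var 0\<close>, so \<open>L\<close>,
  \<open>y\<close>, \<open>z\<close> are again coordinates: \<open>var 0\<close> is replaced by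
  \<open>L - c y - c^2 z\<close>.\<close>

lemma homog_Suc_decomp:
  assumes "f \<in> homog (Suc s)"
  obtains f0 f1 f2 where "f0 \<in> homog s" "f1 \<in> homog s" "f2 \<in> homog s" "f = L * f0 + y * f1 + z * f2"
proof -
  obtain g where g: "\<And>i. g i \<in> homog s" "f = (\<Sum>i\<in>UNIV. var i * g i)"
    using homog_Suc_decomp_vars[OF assms] by blast
  have "f = var 0 * g 0 + y * g 1 + z * g 2"
    by (simp add: g(2) sum_3 three_eq_0 add_ac)
  also have "\<dots> = L * g 0 + y * (g 1 - pm_scale c (g 0)) + z * (g 2 - pm_scale (c ^ 2) (g 0))"
    by (simp add: L_def algebra_simps pm_scale_mult_left pm_scale_mult_right)
  finally show ?thesis using that g(1) by (metis homog_diff homog_scale)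
qed

definition chart_monomials :: "nat \<Rightarrow> 'k poly3 set" where
  "chart_monomials t = {L ^ h * y ^ i * z ^ j | h i j. h + i + j = t}"

lemma chart_monomialsI: "h + i + j = t \<Longrightarrow> L ^ h * y ^ i * z ^ j \<in> chart_monomials t"
  unfolding chart_monomials_def by blast

lemma finite_chart_monomials: "finite (chart_monomials t)"
proof -
  have "chart_monomials t \<subseteq> (\<lambda>(h, i, j). L ^ h * y ^ i * z ^ j) ` ({..t} \<times> {..t} \<times> {..t})"
  proof
    fix m assume "m \<in> chart_monomials t"
    then obtain h i j where "m = L ^ h * y ^ i * z ^ j" "h + i + j = t" by (auto simp: chart_monomials_def)
    then show "m \<in> (\<lambda>(h, i, j). L ^ h * y ^ i * z ^ j) ` ({..t} \<times> {..t} \<times> {..t})"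
      by (intro image_eqI[of _ _ "(h, i, j)"]) auto
  qed
  then show ?thesis by (rule finite_subset) auto
qed

text \<open>Besides the new coordinates, this supplies the finite spanning sets that the dimension
  lemmas ask for.\<close>

lemma homog_subset_span: "homog t \<subseteq> pm.span (chart_monomials t)"
proof (induction t)
  case 0
  have "1 \<in> chart_monomials 0" using chart_monomialsI[of 0 0 0] by simp
  then show ?case by (auto simp: homog_0 intro: pm.span_scale pm.span_base)
next
  case (Suc t)
  have *: "l * f \<in> pm.span (chart_monomials (Suc t))"
    if l: "\<And>m. m \<in> chart_monomials t \<Longrightarrow> l * m \<in> chart_monomials (Suc t)" and f: "f \<in> homog t" for l f
    using subsetD[OF Suc f]
  proof (induction rule: pm.span_induct_alt)
    case (step d x w)
    show ?case
      unfolding distrib_left pm_scale_mult_right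
      by (rule pm.span_add[OF pm.span_scale[OF pm.span_base[OF l[OF step(1)]]] step(2)])
  qed (simp add: pm.span_zero)
  have gen: "l * m \<in> chart_monomials (Suc t)" if m: "m \<in> chart_monomials t" and l: "l \<in> {L, y, z}" for l m
  proof -
    obtain h i j where m: "m = L ^ h * y ^ i * z ^ j" "h + i + j = t"
      using m by (auto simp: chart_monomials_def)
    have eqs: "L * m = L ^ Suc h * y ^ i * z ^ j" "y * m = L ^ h * y ^ Suc i * z ^ j" "z * m = L ^ h * y ^ i * z ^ Suc j"
      by (simp_all add: m mult_ac)
    have "L * m \<in> chart_monomials (Suc t)" "y * m \<in> chart_monomials (Suc t)" "z * m \<in> chart_monomials (Suc t)"
      unfolding eqs by (rule chart_monomialsI, use m(2) in simp)+
    then show ?thesis using l by blast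
  qed
  show ?case
  proof
    fix f :: "'k poly3" assume "f \<in> homog (Suc t)"
    then obtain f0 f1 f2 where f: "f0 \<in> homog t" "f1 \<in> homog t" "f2 \<in> homog t" "f = L * f0 + y * f1 + z * f2"
      by (rule homog_Suc_decomp)
    show "f \<in> pm.span (chart_monomials (Suc t))"
      unfolding f(4) by (intro pm.span_add *[OF gen f(1)] *[OF gen f(2)] *[OF gen f(3)]) simp_all
  qed
qed

lemma chart_monomials_subset_homog: "chart_monomials t \<subseteq> homog t"
proof
  fix m assume "m \<in> chart_monomials t"
  then obtain h i j where m: "m = L ^ h * y ^ i * z ^ j" "t = h + i + j"
    by (auto simp: chart_monomials_def)
  show "m \<in> homog t"
    unfolding m using homog_power[OF L_homog, of h] homog_power[OF var_homog, of 1 i] homog_power[OF var_homog, of 2 j]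
    by (intro homog_mult) auto
qed

text \<open>This is dehomogenization, as \<open>L\<close> is 1 on the chart. It turns separating
  forms into the interpolation hypothesis of \<open>bezoutian_identity\<close>.\<close>

lemma eval3_on_chart:
  assumes "f \<in> homog t"
  shows "\<exists>a. \<forall>v\<in>chart. eval3 f v = (\<Sum>(i, j)\<in>{(i, j). i + j \<le> t}. a (i, j) * (v $ 1 ^ i * v $ 2 ^ j))"
  using subsetD[OF homog_subset_span assms]
proof (induction rule: pm.span_induct_alt)
  case base
  show ?case by (rule exI[of _ "\<lambda>_. 0"]) simp
next
  case (step d x w)
  then obtain a where a: "\<And>v. v \<in> chart \<Longrightarrow> eval3 w v = (\<Sum>(i, j)\<in>{(i, j). i + j \<le> t}. a (i, j) * (v $ 1 ^ i * v $ 2 ^ j))"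
    by blast
  obtain h k l where x: "x = L ^ h * y ^ k * z ^ l" "h + k + l = t"
    using step by (auto simp: chart_monomials_def)
  have fin: "finite {(i, j). i + j \<le> t}"
    by (rule finite_subset[of _ "{..t} \<times> {..t}"]) auto
  have "eval3 (pm_scale d x + w) v =
      (\<Sum>(i, j)\<in>{(i, j). i + j \<le> t}. (a (i, j) + (if (i, j) = (k, l) then d else 0)) * (v $ 1 ^ i * v $ 2 ^ j))"
    if v: "v \<in> chart" for v
  proof -
    have "(\<Sum>u\<in>{(i, j). i + j \<le> t}. (if u = (k, l) then d * (v $ 1 ^ k * v $ 2 ^ l) else 0)) = d * (v $ 1 ^ k * v $ 2 ^ l)"
      using fin x(2) by (simp add: sum.delta)
    moreover have "(\<Sum>(i, j)\<in>{(i, j). i + j \<le> t}. (a (i, j) + (if (i, j) = (k, l) then d else 0)) * (v $ 1 ^ i * v $ 2 ^ j)) =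
       (\<Sum>(i, j)\<in>{(i, j). i + j \<le> t}. a (i, j) * (v $ 1 ^ i * v $ 2 ^ j)) +
       (\<Sum>u\<in>{(i, j). i + j \<le> t}. (if u = (k, l) then d * (v $ 1 ^ k * v $ 2 ^ l) else 0))"
      unfolding sum.distrib[symmetric] by (intro sum.cong refl) (auto simp: distrib_right split: if_splits)
    ultimately show ?thesis using a[OF v] by (simp add: x(1) eval3_L[OF v])
  qed
  then show ?case by (intro exI[of _ "\<lambda>u. a u + (if u = (k, l) then d else 0)"]) auto
qed

end

section \<open>Separating forms and functionals modulo the image of the multiplication map\<close>

definition separates :: "('k::field ^ 3) set \<Rightarrow> 'k ^ 3 \<Rightarrow> nat \<Rightarrow> bool" where
  "separates W p t \<longleftrightarrow> (\<exists>f\<in>forms_vanishing (W - {p}) t. eval3 f p \<noteq> 0)"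

text \<open>The form \<open>F p\<close> separates \<open>p\<close> from the rest of \<open>W\<close>. Removing \<open>p\<close> enlarges the degree \<open>s\<close> part of
  the ideal by \<open>F p\<close>, hence its linear multiples by \<open>L * F p\<close>, \<open>u p\<close> and \<open>v p\<close>, of which the last two
  still vanish on all of \<open>W\<close>.\<close>

locale separated_points = affine_chart c for c :: "'k::field" +
  fixes W :: "('k ^ 3) set" and s :: nat and F :: "'k ^ 3 \<Rightarrow> 'k poly3"
  assumes fin: "finite W"
    and W_chart: "W \<subseteq> chart"
    and F_homog: "p \<in> W \<Longrightarrow> F p \<in> homog s"
    and F_eval: "p \<in> W \<Longrightarrow> q \<in> W \<Longrightarrow> eval3 (F p) q = (if p = q then 1 else 0)"
begin

definition u :: "'k ^ 3 \<Rightarrow> 'k poly3" where "u p = (y - pm_scale (p $ 1) L) * F p"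
definition v :: "'k ^ 3 \<Rightarrow> 'k poly3" where "v p = (z - pm_scale (p $ 2) L) * F p"

abbreviation T :: "'k poly3 set" where "T \<equiv> linear_multiples (forms_vanishing W s)"

lemma eval3_L_W: "p \<in> W \<Longrightarrow> eval3 L p = 1"
  using W_chart eval3_L by blast

lemma tangent_homog: "y - pm_scale a L \<in> homog (Suc 0)" "z - pm_scale a L \<in> homog (Suc 0)"
  by auto

lemma tangent_mult_vanishing:
  assumes p: "p \<in> W" and G: "G \<in> forms_vanishing (W - {p}) t"
  shows "(y - pm_scale (p $ 1) L) * G \<in> forms_vanishing W (Suc t)"
    and "(z - pm_scale (p $ 2) L) * G \<in> forms_vanishing W (Suc t)"
  using homog_mult[OF tangent_homog(1), of G t] homog_mult[OF tangent_homog(2), of G t] G eval3_L_W[OF p]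
  by (auto simp: forms_vanishing_def)

lemma F_vanishing: "p \<in> W \<Longrightarrow> F p \<in> forms_vanishing (W - {p}) s"
  using F_homog F_eval by (auto simp: forms_vanishing_def)

lemma u_vanishing: "p \<in> W \<Longrightarrow> u p \<in> forms_vanishing W (Suc s)"
  and v_vanishing: "p \<in> W \<Longrightarrow> v p \<in> forms_vanishing W (Suc s)"
  unfolding u_def v_def by (rule tangent_mult_vanishing F_vanishing | assumption)+

lemma interpolant_remainder:
  assumes "f \<in> homog s"
  shows "f - (\<Sum>p\<in>W. pm_scale (eval3 f p) (F p)) \<in> forms_vanishing W s"
  unfolding forms_vanishing_def
proof (intro CollectI conjI ballI)
  show "f - (\<Sum>p\<in>W. pm_scale (eval3 f p) (F p)) \<in> homog s"
    using assms by (intro homog_diff homog_sum homog_scale F_homog)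
  fix q assume q: "q \<in> W"
  have "(\<Sum>p\<in>W. eval3 f p * eval3 (F p) q) = (\<Sum>p\<in>W. if p = q then eval3 f q else 0)"
    by (intro sum.cong refl) (auto simp: F_eval q)
  then show "eval3 (f - (\<Sum>p\<in>W. pm_scale (eval3 f p) (F p))) q = 0"
    using q fin by (simp add: eval3_sum)
qed

text \<open>Replacing the coefficient forms by their Lagrange interpolants changes \<open>g\<close>
  by an element of \<open>T\<close>. Writing \<open>y\<close> as
  \<open>(y - p $ 1 L) + p $ 1 L\<close>, and \<open>z\<close> likewise, collects at
  \<open>L * F p\<close> the coefficient \<open>eval3 g p\<close>, since \<open>L\<close> is 1 at
  \<open>p\<close>.\<close>

lemma decomp_mod_T:
  assumes f: "f0 \<in> homog s" "f1 \<in> homog s" "f2 \<in> homog s"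
    and g: "g = L * f0 + y * f1 + z * f2"
  shows "g - (\<Sum>p\<in>W. pm_scale (eval3 g p) (L * F p) + pm_scale (eval3 f1 p) (u p) + pm_scale (eval3 f2 p) (v p)) \<in> T"
proof -
  let ?r = "\<lambda>f. \<Sum>p\<in>W. pm_scale (eval3 f p) (F p)"
  have "L * (f0 - ?r f0) + y * (f1 - ?r f1) + z * (f2 - ?r f2) \<in> T"
    by (intro pm.subspace_add[OF subspace_linear_multiples] linear_multiplesI interpolant_remainder f) auto
  moreover have "L * ?r f0 + y * ?r f1 + z * ?r f2 =
      (\<Sum>p\<in>W. pm_scale (eval3 g p) (L * F p) + pm_scale (eval3 f1 p) (u p) + pm_scale (eval3 f2 p) (v p))"
    unfolding sum_distrib_left sum.distrib[symmetric]
  proof (intro sum.cong refl)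
    fix p assume p: "p \<in> W"
    show "L * pm_scale (eval3 f0 p) (F p) + y * pm_scale (eval3 f1 p) (F p) + z * pm_scale (eval3 f2 p) (F p) =
       pm_scale (eval3 g p) (L * F p) + pm_scale (eval3 f1 p) (u p) + pm_scale (eval3 f2 p) (v p)"
      by (simp add: g u_def v_def eval3_L_W[OF p] left_diff_distrib right_diff_distrib pm_scale_mult_left pm_scale_mult_right
          pm.scale_right_diff_distrib pm.scale_left_distrib mult.commute)
  qed
  ultimately show ?thesis
    by (simp add: g right_diff_distrib algebra_simps)
qed

text \<open>The coefficients of \<open>L * F p\<close> in \<open>decomp_mod_T\<close> are values of
  the form at points of \<open>W\<close>. For a form vanishing on \<open>W\<close> only the terms
  \<open>u p\<close> and \<open>v p\<close> remain modulo \<open>T\<close>.\<close>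

lemma linear_multiples_eqI:
  assumes "\<And>p. p \<in> W \<Longrightarrow> u p \<in> U" "\<And>p. p \<in> W \<Longrightarrow> v p \<in> U" "T \<subseteq> U" "pm.subspace U"
  shows "forms_vanishing W (Suc s) \<subseteq> U"
proof
  fix f assume f: "f \<in> forms_vanishing W (Suc s)"
  then have "f \<in> homog (Suc s)" and f0: "\<And>p. p \<in> W \<Longrightarrow> eval3 f p = 0"
    by (auto simp: forms_vanishing_def)
  then obtain f0 f1 f2 where d: "f0 \<in> homog s" "f1 \<in> homog s" "f2 \<in> homog s" "f = L * f0 + y * f1 + z * f2"
    using homog_Suc_decomp by metis
  have "(\<Sum>p\<in>W. pm_scale (eval3 f p) (L * F p) + pm_scale (eval3 f1 p) (u p) + pm_scale (eval3 f2 p) (v p)) \<in> U"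
    using assms(1,2) f0
    by (intro pm.subspace_sum[OF assms(4)]) (auto intro!: pm.subspace_add[OF assms(4)] pm.subspace_scale[OF assms(4)])
  from pm.subspace_add[OF assms(4) subsetD[OF assms(3) decomp_mod_T[OF d]] this]
  show "f \<in> U" by simp
qed

text \<open>Up to a scalar, \<open>F p\<close> and \<open>L * G\<close> differ by a form that
  vanishes on \<open>W\<close>. If \<open>l\<close> is a linear form vanishing at \<open>p\<close>,
  then \<open>l * G\<close> already vanishes on \<open>W\<close>, so
  \<open>l * (L * G) = L * (l * G)\<close> lies in \<open>T\<close>.\<close>

lemma uv_in_T:
  assumes p: "p \<in> W" and sep: "separates W p t" and s: "s = Suc t"
  shows "u p \<in> T" "v p \<in> T"
proof -
  obtain G where G: "G \<in> forms_vanishing (W - {p}) t" "eval3 G p \<noteq> 0"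
    using sep by (auto simp: separates_def)
  define R where "R = F p - pm_scale (1 / eval3 G p) (L * G)"
  have "L * G \<in> homog (Suc t)" using homog_mult[OF L_homog, of G t] G by (auto simp: forms_vanishing_def)
  moreover have "eval3 R q = 0" if q: "q \<in> W" for q
    using q G F_eval[OF p q] eval3_L_W[OF p] by (cases "q = p") (auto simp: R_def forms_vanishing_def)
  ultimately have R: "R \<in> forms_vanishing W s"
    using F_homog[OF p] by (auto simp: R_def forms_vanishing_def s)
  have *: "l * F p \<in> T" if l: "l \<in> homog (Suc 0)" "l * G \<in> forms_vanishing W (Suc t)" for l
  proof -
    have "l * F p = l * R + pm_scale (1 / eval3 G p) (L * (l * G))"
      by (simp add: R_def right_diff_distrib pm_scale_mult_right mult.left_commute)
    then show ?thesis
      using R l by (auto simp: s intro!: pm.subspace_add[OF subspace_linear_multiples]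
          pm.subspace_scale[OF subspace_linear_multiples] linear_multiplesI)
  qed
  show "u p \<in> T" "v p \<in> T"
    unfolding u_def v_def by (intro * tangent_homog tangent_mult_vanishing[OF p G(1)])+
qed

text \<open>A functional that vanishes on \<open>T\<close>, corrected by a combination of point evaluations so that it
  also vanishes on all multiples of \<open>L\<close>; on forms vanishing on \<open>W\<close> it is unchanged.\<close>

definition residual :: "('k poly3 \<Rightarrow> 'k) \<Rightarrow> 'k poly3 \<Rightarrow> 'k" where
  "residual \<Phi> f = \<Phi> f - (\<Sum>p\<in>W. eval3 f p * \<Phi> (L * F p))"

context
  fixes \<Phi> :: "'k poly3 \<Rightarrow> 'k"
  assumes lin: "Vector_Spaces.linear pm_scale (*) \<Phi>" and ker: "\<And>f. f \<in> T \<Longrightarrow> \<Phi> f = 0"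
begin

interpretation \<Phi>: Vector_Spaces.linear pm_scale "(*)" \<Phi>
  by (rule lin)

lemma residual_add: "residual \<Phi> (f + g) = residual \<Phi> f + residual \<Phi> g"
  by (simp add: residual_def \<Phi>.add distrib_right sum.distrib)

lemma residual_scale: "residual \<Phi> (pm_scale a f) = a * residual \<Phi> f"
  by (simp add: residual_def \<Phi>.scale right_diff_distrib sum_distrib_left mult.assoc)

lemma residual_0: "residual \<Phi> 0 = 0"
  by (simp add: residual_def \<Phi>.zero)

lemma residual_vanishing: "f \<in> forms_vanishing W t \<Longrightarrow> residual \<Phi> f = \<Phi> f"
  by (simp add: residual_def forms_vanishing_def)

text \<open>The correction in \<open>residual\<close> cancels precisely the terms
  \<open>L * F p\<close> of \<open>decomp_mod_T\<close>.\<close>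

lemma residual_decomp:
  assumes "f0 \<in> homog s" "f1 \<in> homog s" "f2 \<in> homog s"
  shows "residual \<Phi> (L * f0 + y * f1 + z * f2) = (\<Sum>p\<in>W. \<Phi> (u p) * eval3 f1 p) + (\<Sum>p\<in>W. \<Phi> (v p) * eval3 f2 p)"
proof -
  define g where "g = L * f0 + y * f1 + z * f2"
  from ker[OF decomp_mod_T[OF assms g_def]]
  have "\<Phi> g = (\<Sum>p\<in>W. eval3 g p * \<Phi> (L * F p)) + (\<Sum>p\<in>W. eval3 f1 p * \<Phi> (u p)) + (\<Sum>p\<in>W. eval3 f2 p * \<Phi> (v p))"
    by (simp only: \<Phi>.diff \<Phi>.sum \<Phi>.add \<Phi>.scale sum.distrib right_minus_eq)
  then show ?thesis unfolding g_def[symmetric] residual_def by (simp add: mult.commute)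
qed

lemma residual_L: "g \<in> homog s \<Longrightarrow> residual \<Phi> (L * g) = 0"
  using residual_decomp[of g 0 0] by (simp add: pm.subspace_0[OF subspace_homog])

lemma residual_y: "g \<in> homog s \<Longrightarrow> residual \<Phi> (y * g) = (\<Sum>p\<in>W. \<Phi> (u p) * eval3 g p)"
  using residual_decomp[of 0 g 0] by (simp add: pm.subspace_0[OF subspace_homog])

lemma residual_z: "g \<in> homog s \<Longrightarrow> residual \<Phi> (z * g) = (\<Sum>p\<in>W. \<Phi> (v p) * eval3 g p)"
  using residual_decomp[of 0 0 g] by (simp add: pm.subspace_0[OF subspace_homog])

lemma monomial_homog: "L ^ h * y ^ i * z ^ j \<in> homog (h + i + j)"
  using chart_monomials_subset_homog[of "h + i + j"] by (auto simp: chart_monomials_def)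

text \<open>In degree below \<open>s\<close> there is room for a factor \<open>L\<close>, and
  \<open>y * (L * g) = L * (y * g)\<close> is killed as a multiple of \<open>L\<close>.\<close>

lemma moments_low:
  assumes "i + j < s"
  shows "(\<Sum>p\<in>W. \<Phi> (u p) * (p $ 1 ^ i * p $ 2 ^ j)) = 0"
    and "(\<Sum>p\<in>W. \<Phi> (v p) * (p $ 1 ^ i * p $ 2 ^ j)) = 0"
proof -
  \<comment> \<open>The exponent fills \<open>g\<close> up to degree \<open>s - 1\<close>, leaving
    one more factor \<open>L\<close> to reach degree \<open>s\<close>.\<close>
  define h where "h = s - Suc (i + j)"
  define g where "g = L ^ h * y ^ i * z ^ j"
  have g: "g \<in> homog (h + i + j)" unfolding g_def by (rule monomial_homog)
  have s: "s = Suc 0 + (h + i + j)" using assms by (simp add: h_def)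
  have lg: "L * g \<in> homog s" "y * g \<in> homog s" "z * g \<in> homog s"
    unfolding s by (intro homog_mult g L_homog var_homog)+
  have e: "eval3 (L * g) p = p $ 1 ^ i * p $ 2 ^ j" if "p \<in> W" for p
    using that by (simp add: g_def eval3_L_W)
  have "residual \<Phi> (y * (L * g)) = residual \<Phi> (L * (y * g))" "residual \<Phi> (z * (L * g)) = residual \<Phi> (L * (z * g))"
    by (simp_all add: mult.left_commute)
  then have "(\<Sum>p\<in>W. \<Phi> (u p) * eval3 (L * g) p) = 0" "(\<Sum>p\<in>W. \<Phi> (v p) * eval3 (L * g) p) = 0"
    using residual_y[OF lg(1)] residual_z[OF lg(1)] residual_L[OF lg(2)] residual_L[OF lg(3)] by simp_all
  then show "(\<Sum>p\<in>W. \<Phi> (u p) * (p $ 1 ^ i * p $ 2 ^ j)) = 0" "(\<Sum>p\<in>W. \<Phi> (v p) * (p $ 1 ^ i * p $ 2 ^ j)) = 0"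
    by (simp_all add: e del: eval3_mult)
qed

text \<open>The same monomial is multiplied by \<open>y\<close> for the weights \<open>u\<close> and
  by \<open>z\<close> for the weights \<open>v\<close>. This gives the index shift between the
  \<open>a\<close> and the \<open>b\<close> in \<open>bezoutian_identity\<close>.\<close>

lemma moments_top:
  assumes "i + j = s"
  shows "(\<Sum>p\<in>W. \<Phi> (u p) * (p $ 1 ^ i * p $ 2 ^ j)) = residual \<Phi> (y ^ Suc i * z ^ (Suc s - Suc i))"
    and "(\<Sum>p\<in>W. \<Phi> (v p) * (p $ 1 ^ i * p $ 2 ^ j)) = residual \<Phi> (y ^ i * z ^ (Suc s - i))"
proof -
  have g: "y ^ i * z ^ j \<in> homog s" using monomial_homog[of 0 i j] assms by simp
  have "Suc s - Suc i = j" "Suc s - i = Suc j" using assms by auto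
  then show "(\<Sum>p\<in>W. \<Phi> (u p) * (p $ 1 ^ i * p $ 2 ^ j)) = residual \<Phi> (y ^ Suc i * z ^ (Suc s - Suc i))"
    "(\<Sum>p\<in>W. \<Phi> (v p) * (p $ 1 ^ i * p $ 2 ^ j)) = residual \<Phi> (y ^ i * z ^ (Suc s - i))"
    using residual_y[OF g] residual_z[OF g] by (simp_all add: mult_ac)
qed

end

text \<open>The residuals vanish on multiples of \<open>L\<close>, so they are determined by their
  values on \<open>y^n z^(s+1-n)\<close>. There \<open>bezoutian_identity\<close> applies with the
  values of the functionals on \<open>u p\<close> and \<open>v p\<close> as weights, and bilinearity
  extends the relation to all forms.\<close>

lemma functionals_proportional:
  assumes lin: "Vector_Spaces.linear pm_scale (*) \<Phi>1" "Vector_Spaces.linear pm_scale (*) \<Phi>2"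
    and ker: "\<And>f. f \<in> T \<Longrightarrow> \<Phi>1 f = 0" "\<And>f. f \<in> T \<Longrightarrow> \<Phi>2 f = 0"
    and det0: "\<And>p. p \<in> W \<Longrightarrow> \<Phi>1 (u p) * \<Phi>2 (v p) = \<Phi>1 (v p) * \<Phi>2 (u p)"
    and f: "f \<in> forms_vanishing W (Suc s)" and g: "g \<in> forms_vanishing W (Suc s)"
  shows "\<Phi>1 f * \<Phi>2 g = \<Phi>1 g * \<Phi>2 f"
proof -
  let ?r1 = "residual \<Phi>1" and ?r2 = "residual \<Phi>2"
  note add = residual_add[OF lin(1) ker(1)] residual_add[OF lin(2) ker(2)]
  note scale = residual_scale[OF lin(1) ker(1)] residual_scale[OF lin(2) ker(2)]
  note zero = residual_0[OF lin(1) ker(1)] residual_0[OF lin(2) ker(2)]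
  have interp: "\<exists>a. \<forall>p\<in>W. h p = (\<Sum>(i, j)\<in>{(i, j). i + j \<le> s}. a (i, j) * (p $ 1 ^ i * p $ 2 ^ j))" for h
  proof -
    define H where "H = (\<Sum>q\<in>W. pm_scale (h q) (F q))"
    have H: "H \<in> homog s" unfolding H_def by (intro homog_sum homog_scale F_homog)
    have Hh: "eval3 H p = h p" if p: "p \<in> W" for p
    proof -
      have "eval3 H p = (\<Sum>q\<in>W. if q = p then h p else 0)"
        unfolding H_def eval3_sum by (intro sum.cong refl) (auto simp: F_eval p)
      then show ?thesis using p fin by simp
    qed
    obtain a where a: "\<And>x. x \<in> chart \<Longrightarrow> eval3 H x = (\<Sum>(i, j)\<in>{(i, j). i + j \<le> s}. a (i, j) * (x $ 1 ^ i * x $ 2 ^ j))"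
      using eval3_on_chart[OF H] by blast
    show ?thesis
    proof (intro exI[of _ a] ballI)
      fix p assume p: "p \<in> W"
      then have "p \<in> chart" using W_chart by blast
      from a[OF this] Hh[OF p]
      show "h p = (\<Sum>(i, j)\<in>{(i, j). i + j \<le> s}. a (i, j) * (p $ 1 ^ i * p $ 2 ^ j))" by simp
    qed
  qed
  have inj: "p = q" if "p \<in> W" "q \<in> W" "p $ 1 = q $ 1" "p $ 2 = q $ 2" for p q
    using chart_eqI that W_chart by blast
  define \<phi>1 \<phi>2 where "\<phi>1 n = ?r1 (y ^ n * z ^ (Suc s - n))" and "\<phi>2 n = ?r2 (y ^ n * z ^ (Suc s - n))" for n
  have top: "\<phi>1 n * \<phi>2 n' = \<phi>1 n' * \<phi>2 n" if "n \<le> Suc s" "n' \<le> Suc s" for n n'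
    by (rule bezoutian_identity[where y = "\<lambda>p. p $ 1" and z = "\<lambda>p. p $ 2", OF fin inj
        moments_low(1)[OF lin(1) ker(1)] moments_low(1)[OF lin(2) ker(2)]
        moments_low(2)[OF lin(1) ker(1)] moments_low(2)[OF lin(2) ker(2)]
        moments_top(1)[OF lin(1) ker(1), folded \<phi>1_def] moments_top(1)[OF lin(2) ker(2), folded \<phi>2_def]
        moments_top(2)[OF lin(1) ker(1), folded \<phi>1_def] moments_top(2)[OF lin(2) ker(2), folded \<phi>2_def]
        det0 interp that])
  have mono: "?r1 m * ?r2 m' = ?r1 m' * ?r2 m"
    if m: "m \<in> chart_monomials (Suc s)" "m' \<in> chart_monomials (Suc s)" for m m'
  proof -
    have cases: "(?r1 m = 0 \<and> ?r2 m = 0) \<or> (\<exists>n\<le>Suc s. m = y ^ n * z ^ (Suc s - n))"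
      if m: "m \<in> chart_monomials (Suc s)" for m
    proof -
      obtain h i j where m: "m = L ^ h * y ^ i * z ^ j" "h + i + j = Suc s"
        using m by (auto simp: chart_monomials_def)
      show ?thesis
      proof (cases h)
        case 0
        then have "j = Suc s - i" "i \<le> Suc s" using m(2) by auto
        then show ?thesis using m(1) 0 by auto
      next
        case (Suc h')
        then have "m = L * (L ^ h' * y ^ i * z ^ j)" "L ^ h' * y ^ i * z ^ j \<in> homog s"
          using m monomial_homog[OF lin(1) ker(1), of h' i j] by (auto simp: mult_ac)
        then show ?thesis using residual_L[OF lin(1) ker(1)] residual_L[OF lin(2) ker(2)] by metis
      qed
    qed
    consider "?r1 m = 0" "?r2 m = 0" | "?r1 m' = 0" "?r2 m' = 0"
      | n n' where "n \<le> Suc s" "n' \<le> Suc s" "m = y ^ n * z ^ (Suc s - n)" "m' = y ^ n' * z ^ (Suc s - n')"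
      using cases[OF m(1)] cases[OF m(2)] by blast
    then show ?thesis
    proof cases
      case (3 n n')
      then show ?thesis using top[of n n'] unfolding \<phi>1_def \<phi>2_def by simp
    qed auto
  qed
  have span1: "?r1 m * ?r2 g = ?r1 g * ?r2 m"
    if m: "m \<in> chart_monomials (Suc s)" and g: "g \<in> pm.span (chart_monomials (Suc s))" for m g
    using g
  proof (induction rule: pm.span_induct_alt)
    case (step a x w)
    then show ?case using mono[OF m, of x] by (simp add: add scale algebra_simps)
  qed (simp add: zero)
  have span2: "?r1 f * ?r2 g = ?r1 g * ?r2 f"
    if f: "f \<in> pm.span (chart_monomials (Suc s))" and g: "g \<in> pm.span (chart_monomials (Suc s))" for f g
    using f
  proof (induction rule: pm.span_induct_alt)
    case (step a x w)
    then show ?case using span1[of x, OF _ g] by (simp add: add scale algebra_simps)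
  qed (simp add: zero)
  have "f \<in> pm.span (chart_monomials (Suc s))" "g \<in> pm.span (chart_monomials (Suc s))"
    using f g homog_subset_span[of "Suc s"] by (auto simp: forms_vanishing_def)
  from span2[OF this] show ?thesis
    using residual_vanishing[OF lin(1) ker(1)] residual_vanishing[OF lin(2) ker(2)] f g by simp
qed

end

section \<open>Removal of a single point\<close>

context separated_points
begin

lemma T_subset_removal: "T \<subseteq> linear_multiples (forms_vanishing (W - {p}) s)"
  by (intro linear_multiples_mono forms_vanishing_antimono) auto

lemma multiples_of_F_in_removal:
  assumes "p \<in> W" "l \<in> homog (Suc 0)"
  shows "l * F p \<in> linear_multiples (forms_vanishing (W - {p}) s)"
  using assms by (intro linear_multiplesI F_vanishing) auto

lemma uv_in_removal:
  assumes "p \<in> W"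
  shows "u p \<in> linear_multiples (forms_vanishing (W - {p}) s)"
    and "v p \<in> linear_multiples (forms_vanishing (W - {p}) s)"
  unfolding u_def v_def using assms by (auto intro: multiples_of_F_in_removal)

text \<open>Subtracting the multiple of \<open>L * F p\<close> with the same value at
  \<open>p\<close> makes a form vanish on all of \<open>W\<close>.\<close>

lemma removal_full:
  assumes p: "p \<in> W" and sub: "forms_vanishing W (Suc s) \<subseteq> linear_multiples (forms_vanishing (W - {p}) s)"
  shows "forms_vanishing (W - {p}) (Suc s) \<subseteq> linear_multiples (forms_vanishing (W - {p}) s)"
proof
  fix f assume f: "f \<in> forms_vanishing (W - {p}) (Suc s)"
  let ?g = "pm_scale (eval3 f p) (L * F p)"
  have LF: "L * F p \<in> homog (Suc s)" using homog_mult[OF L_homog F_homog[OF p]] by simp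
  have "eval3 (f - ?g) q = 0" if "q \<in> W" for q
    using that f p F_eval[OF p that] eval3_L_W[OF p]
    by (cases "q = p") (auto simp: forms_vanishing_def)
  moreover have "f - ?g \<in> homog (Suc s)"
    using f LF by (auto simp: forms_vanishing_def)
  ultimately have "f - ?g \<in> linear_multiples (forms_vanishing (W - {p}) s)"
    using sub by (auto simp: forms_vanishing_def)
  moreover have "?g \<in> linear_multiples (forms_vanishing (W - {p}) s)"
    by (intro pm.subspace_scale[OF subspace_linear_multiples] multiples_of_F_in_removal p L_homog)
  ultimately have "f - ?g + ?g \<in> linear_multiples (forms_vanishing (W - {p}) s)"
    by (rule pm.subspace_add[OF subspace_linear_multiples])
  then show "f \<in> linear_multiples (forms_vanishing (W - {p}) s)" by simp
qed

text \<open>\<open>L * F p\<close> is the third new direction: all elements of \<open>T\<close>,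
  \<open>u p\<close> and \<open>v p\<close> vanish at \<open>p\<close>, but \<open>L * F p\<close>
  does not.\<close>

lemma removal_dim:
  assumes p: "p \<in> W" and u: "u p \<notin> T" and v: "v p \<notin> pm.span (insert (u p) T)"
  shows "pm.dim T + 3 \<le> pm.dim (linear_multiples (forms_vanishing (W - {p}) s))"
proof -
  let ?B = "chart_monomials (Suc s)"
  let ?U1 = "pm.span (insert (u p) T)"
  let ?U2 = "pm.span (insert (v p) ?U1)"
  let ?U3 = "pm.span (insert (L * F p) ?U2)"
  have T0: "T \<subseteq> forms_vanishing W (Suc s)"
    by (rule linear_multiples_forms_vanishing)
  then have T1: "?U1 \<subseteq> forms_vanishing W (Suc s)"
    using u_vanishing[OF p] by (intro pm.span_minimal) auto
  then have T2: "?U2 \<subseteq> forms_vanishing W (Suc s)"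
    using v_vanishing[OF p] by (intro pm.span_minimal) auto
  have B: "forms_vanishing Q (Suc s) \<subseteq> pm.span ?B" for Q
    using homog_subset_span[of "Suc s"] by (auto simp: forms_vanishing_def)
  have "L * F p \<notin> ?U2"
  proof
    assume "L * F p \<in> ?U2"
    then have "L * F p \<in> forms_vanishing W (Suc s)" using T2 by blast
    then have "eval3 (L * F p) p = 0" using p unfolding forms_vanishing_def by blast
    then show False using F_eval[OF p p] eval3_L_W[OF p] by simp
  qed
  then have "pm.dim ?U3 = Suc (pm.dim ?U2)"
    using order_trans[OF T2 B] finite_chart_monomials by (intro pm.dim_span_insert[of _ ?B]) auto
  also have "pm.dim ?U2 = Suc (pm.dim ?U1)"
    using order_trans[OF T1 B] finite_chart_monomials v by (intro pm.dim_span_insert[of _ ?B]) auto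
  also have "pm.dim ?U1 = Suc (pm.dim T)"
    using order_trans[OF T0 B] finite_chart_monomials u by (intro pm.dim_span_insert[of _ ?B]) auto
  finally have "pm.dim ?U3 = pm.dim T + 3" by simp
  moreover have "?U3 \<subseteq> linear_multiples (forms_vanishing (W - {p}) s)"
    using uv_in_removal[OF p] T_subset_removal[of p] multiples_of_F_in_removal[OF p L_homog]
    by (intro pm.span_minimal subspace_linear_multiples insert_subsetI) auto
  then have "pm.dim ?U3 \<le> pm.dim (linear_multiples (forms_vanishing (W - {p}) s))"
    using order_trans[OF linear_multiples_forms_vanishing B] finite_chart_monomials
    by (intro pm.dim_mono_finite[of _ _ ?B]) (auto intro: pm.span_base)
  ultimately show ?thesis by simp
qed

text \<open>The cases are codimension 0, 1 and at least 2 of \<open>T\<close> in the forms of degree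
  \<open>s + 1\<close> vanishing on \<open>W\<close>. In the last two, \<open>uv_in_T\<close> shows
  that the point found is not separated in degree \<open>t\<close>.\<close>

lemma exists_good_removal:
  assumes s: "s = Suc t" and nonsep: "\<exists>p\<in>W. \<not> separates W p t"
  shows "\<exists>p\<in>W. \<not> separates W p t \<and>
    (forms_vanishing (W - {p}) (Suc s) \<subseteq> linear_multiples (forms_vanishing (W - {p}) s) \<or>
     pm.dim T + 3 \<le> pm.dim (linear_multiples (forms_vanishing (W - {p}) s)))"
proof (cases "forms_vanishing W (Suc s) \<subseteq> T")
  case True
  obtain p where p: "p \<in> W" "\<not> separates W p t" using nonsep by blast
  then show ?thesis using removal_full[OF p(1) order_trans[OF True T_subset_removal]] by blast
next
  case False
  then obtain x where x: "x \<in> forms_vanishing W (Suc s)" "x \<notin> T" by blast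
  have spanT: "pm.span T = T" by (simp add: pm.span_eq_iff)
  show ?thesis
  proof (cases "forms_vanishing W (Suc s) \<subseteq> pm.span (insert x T)")
    case True
    \<comment> \<open>In codimension 1 some \<open>u p\<close> or \<open>v p\<close> lies outside
      \<open>T\<close> by \<open>linear_multiples_eqI\<close>. It spans the quotient, and it becomes
      a linear multiple once \<open>p\<close> is removed.\<close>
    obtain p w where p: "p \<in> W" and w: "w = u p \<or> w = v p" "w \<notin> T"
      using linear_multiples_eqI[of T] False by auto
    have "\<not> separates W p t" using uv_in_T[OF p _ s] w by auto
    moreover have "w \<in> pm.span (insert x T)" using u_vanishing[OF p] v_vanishing[OF p] True w(1) by auto
    then have "x \<in> pm.span (insert w T)"
      using pm.in_span_insert[of w x T] w(2) spanT by simp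
    moreover have sub: "pm.span (insert w T) \<subseteq> linear_multiples (forms_vanishing (W - {p}) s)"
      using uv_in_removal[OF p] w(1) T_subset_removal[of p]
      by (intro pm.span_minimal subspace_linear_multiples) auto
    ultimately have "\<not> separates W p t" "x \<in> linear_multiples (forms_vanishing (W - {p}) s)" by auto
    moreover from this(2) have "pm.span (insert x T) \<subseteq> linear_multiples (forms_vanishing (W - {p}) s)"
      using T_subset_removal[of p] by (intro pm.span_minimal subspace_linear_multiples) auto
    ultimately show ?thesis using removal_full[OF p] True p by blast
  next
    case nsub: False
    then obtain x' where x': "x' \<in> forms_vanishing W (Suc s)" "x' \<notin> pm.span (insert x T)" by blast
    \<comment> \<open>By exchange, \<open>x\<close> and \<open>x'\<close> are independent modulo
      \<open>T\<close>. The two functionals are dual to them, hence not proportional.\<close>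
    have "x \<notin> pm.span (insert x' T)"
      using pm.in_span_insert[of x x' T] x' x(2) spanT by auto
    then obtain \<Phi>1 where \<Phi>1: "Vector_Spaces.linear pm_scale (*) \<Phi>1" "\<And>f. f \<in> pm.span (insert x' T) \<Longrightarrow> \<Phi>1 f = 0" "\<Phi>1 x = 1"
      using pm.separating_functional[OF pm.subspace_span] by blast
    obtain \<Phi>2 where \<Phi>2: "Vector_Spaces.linear pm_scale (*) \<Phi>2" "\<And>f. f \<in> pm.span (insert x T) \<Longrightarrow> \<Phi>2 f = 0" "\<Phi>2 x' = 1"
      using pm.separating_functional[OF pm.subspace_span] x'(2) by blast
    have ker: "\<Phi>1 f = 0" "\<Phi>2 f = 0" if "f \<in> T" for f
      using \<Phi>1(2) \<Phi>2(2) that by (auto intro: pm.span_base)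
    have "\<exists>p\<in>W. \<Phi>1 (u p) * \<Phi>2 (v p) \<noteq> \<Phi>1 (v p) * \<Phi>2 (u p)"
    proof (rule ccontr)
      assume "\<not> ?thesis"
      then have "\<Phi>1 x * \<Phi>2 x' = \<Phi>1 x' * \<Phi>2 x"
        using functionals_proportional[OF \<Phi>1(1) \<Phi>2(1) ker _ x(1) x'(1)] by blast
      then show False using \<Phi>1(3) \<Phi>2(3) \<Phi>1(2)[of x'] by (simp add: pm.span_base)
    qed
    then obtain p where p: "p \<in> W" and det: "\<Phi>1 (u p) * \<Phi>2 (v p) \<noteq> \<Phi>1 (v p) * \<Phi>2 (u p)" by blast
    have u: "u p \<notin> T" using ker det by auto
    \<comment> \<open>A relation \<open>v p = w + a (u p)\<close> with \<open>w\<close> in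
      \<open>T\<close> would make the two columns of the determinant proportional.\<close>
    have v: "v p \<notin> pm.span (insert (u p) T)"
    proof
      assume "v p \<in> pm.span (insert (u p) T)"
      then obtain w a where w: "v p = w + pm_scale a (u p)" "w \<in> T"
        using pm.span_insert_eq[OF subspace_linear_multiples] by blast
      interpret l1: Vector_Spaces.linear pm_scale "(*)" \<Phi>1 by (rule \<Phi>1(1))
      interpret l2: Vector_Spaces.linear pm_scale "(*)" \<Phi>2 by (rule \<Phi>2(1))
      have "\<Phi>1 (v p) = a * \<Phi>1 (u p)" "\<Phi>2 (v p) = a * \<Phi>2 (u p)"
        using ker[OF w(2)] by (simp_all add: w(1) l1.add l2.add l1.scale l2.scale)
      then show False using det by simp
    qed
    have "\<not> separates W p t" using uv_in_T(1)[OF p _ s] u by auto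
    then show ?thesis using removal_dim[OF p u v] p by blast
  qed
qed

end

section \<open>Independent conditions and Hilbert functions\<close>

definition pts_hilbert :: "('k::field ^ 3) set \<Rightarrow> nat \<Rightarrow> nat" where
  "pts_hilbert W t = pm.dim (homog t :: 'k poly3 set) - pm.dim (forms_vanishing W t)"

definition independent_conditions :: "('k::field ^ 3) set \<Rightarrow> nat \<Rightarrow> bool" where
  "independent_conditions W t \<longleftrightarrow> (\<forall>p\<in>W. separates W p t)"

lemma forms_vanishing_empty [simp]: "forms_vanishing {} t = homog t"
  by (simp add: forms_vanishing_def)

lemma forms_vanishing_not_separated:
  assumes "\<not> separates W p t"
  shows "forms_vanishing (W - {p}) t = forms_vanishing W t"
  using assms by (auto simp: forms_vanishing_def separates_def)

lemma separates_subset: "separates W p t \<Longrightarrow> V \<subseteq> W \<Longrightarrow> separates V p t"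
  unfolding separates_def forms_vanishing_def by blast

lemma independent_conditions_subset:
  "independent_conditions W t \<Longrightarrow> V \<subseteq> W \<Longrightarrow> independent_conditions V t"
  unfolding independent_conditions_def using separates_subset by blast

lemma exists_independent_subset:
  assumes "finite W"
  shows "\<exists>Y\<subseteq>W. forms_vanishing Y t = forms_vanishing W t \<and> independent_conditions Y t"
  using assms
proof (induction "card W" arbitrary: W rule: less_induct)
  case less
  show ?case
  proof (cases "independent_conditions W t")
    case False
    then obtain p where p: "p \<in> W" "\<not> separates W p t" by (auto simp: independent_conditions_def)
    have "card (W - {p}) < card W" using p less.prems by (intro psubset_card_mono) auto
    from less.hyps[OF this] less.prems
    obtain Y where "Y \<subseteq> W - {p}" "forms_vanishing Y t = forms_vanishing (W - {p}) t" "independent_conditions Y t" by auto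
    then show ?thesis using forms_vanishing_not_separated[OF p(2)] by blast
  qed blast
qed

text \<open>Each further form \<open>f\<close> contributes at most \<open>var 0 * f\<close>,
  \<open>var 1 * f\<close> and \<open>var 2 * f\<close>. Equivalently, the kernel of the
  multiplication map does not shrink when \<open>U\<close> grows; sums replace differences because
  dimensions are natural numbers.\<close>

lemma dim_linear_multiples_le:
  assumes "pm.subspace U" "U \<subseteq> V" "V \<subseteq> pm.span B" "finite B" "pm.subspace V"
    and C: "linear_multiples V \<subseteq> pm.span C" "finite C"
  shows "pm.dim (linear_multiples V) + 3 * pm.dim U \<le> pm.dim (linear_multiples U) + 3 * pm.dim V"
  using assms(1,2)
proof (induction "pm.dim V - pm.dim U" arbitrary: U rule: less_induct)
  case less
  show ?case
  proof (cases "U = V")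
    case False
    then obtain f where f: "f \<in> V" "f \<notin> U" using less.prems by blast
    let ?U' = "pm.span (insert f U)"
    have U': "?U' \<subseteq> V" using f less.prems assms(5) by (intro pm.span_minimal) auto
    have d: "pm.dim ?U' = Suc (pm.dim U)"
      using assms less.prems f by (intro pm.dim_span_insert[of _ B]) auto
    moreover have "pm.dim ?U' \<le> pm.dim V"
      using U' assms by (intro pm.dim_mono_finite[of _ _ B]) (auto intro: pm.span_base)
    ultimately have IH: "pm.dim (linear_multiples V) + 3 * pm.dim ?U' \<le> pm.dim (linear_multiples ?U') + 3 * pm.dim V"
      using U' by (intro less.hyps) auto
    let ?M = "insert (var 0 * f) (insert (var 1 * f) (insert (var 2 * f) (linear_multiples U)))"
    have CU: "linear_multiples U \<subseteq> pm.span C" using linear_multiples_mono[OF less.prems(2)] C(1) by blast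
    have "l * g \<in> pm.span ?M" if l: "l \<in> homog 1" and g: "g \<in> ?U'" for l g
    proof -
      obtain w a where w: "g = w + pm_scale a f" "w \<in> U"
        using g pm.span_insert_eq[OF less.prems(1)] by blast
      obtain h where h: "\<And>i. h i \<in> homog 0" "l = (\<Sum>i\<in>UNIV. var i * h i)"
        using homog_Suc_decomp_vars[of l 0] l by auto
      then have "\<forall>i. \<exists>b. h i = pm_scale b 1" using homog_0 by blast
      then obtain b where b: "\<And>i. h i = pm_scale (b i) 1" by metis
      have "l * f = pm_scale (b 0) (var 0 * f) + pm_scale (b 1) (var 1 * f) + pm_scale (b 2) (var 2 * f)"
        by (simp add: h(2) b sum_3 three_eq_0 distrib_right pm_scale_mult_left pm_scale_mult_right add_ac)
      also have "\<dots> \<in> pm.span ?M"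
        by (intro pm.span_add pm.span_scale pm.span_base) auto
      finally have "l * f \<in> pm.span ?M" .
      moreover have "l * w \<in> pm.span ?M"
        using l w by (intro pm.span_base) (auto intro: linear_multiplesI)
      ultimately show ?thesis
        by (simp add: w distrib_left pm_scale_mult_right pm.span_add pm.span_scale)
    qed
    then have "linear_multiples ?U' \<subseteq> pm.span ?M"
      unfolding linear_multiples_def[of ?U'] by (intro pm.span_minimal) auto
    moreover have M: "linear_multiples U \<subseteq> pm.span (insert a (insert b (insert e C)))" for a b e
      using CU pm.span_mono[of C "insert a (insert b (insert e C))"] by blast
    ultimately have "pm.dim (linear_multiples ?U') \<le> pm.dim ?M"
      using C(2)
      by (intro pm.dim_mono_finite[of _ _ "insert (var 0 * f) (insert (var 1 * f) (insert (var 2 * f) C))"])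
        (auto intro: pm.span_base)
    also have "\<dots> \<le> Suc (pm.dim (insert (var 1 * f) (insert (var 2 * f) (linear_multiples U))))"
      using C(2) M by (intro pm.dim_insert_le[of _ "insert (var 0 * f) (insert (var 1 * f) (insert (var 2 * f) C))"])
        (auto intro: pm.span_base)
    also have "\<dots> \<le> Suc (Suc (pm.dim (insert (var 2 * f) (linear_multiples U))))"
      using C(2) M by (intro le_SucI Suc_le_mono[THEN iffD2] pm.dim_insert_le[of _ "insert (var 0 * f) (insert (var 1 * f) (insert (var 2 * f) C))"])
        (auto intro: pm.span_base)
    also have "\<dots> \<le> Suc (Suc (Suc (pm.dim (linear_multiples U))))"
      using pm.dim_insert_le[OF CU C(2)] by simp
    finally show ?thesis using IH d by simp
  qed simp
qed

context affine_chart
begin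

lemma forms_vanishing_span: "forms_vanishing W t \<subseteq> pm.span (chart_monomials t)"
  using homog_subset_span[of t] by (auto simp: forms_vanishing_def)

lemma dim_forms_vanishing_mono:
  fixes W :: "('k ^ 3) set"
  assumes "forms_vanishing W t \<subseteq> forms_vanishing V t"
  shows "pm.dim (forms_vanishing W t) \<le> pm.dim (forms_vanishing V t)"
  using assms finite_chart_monomials[of t] forms_vanishing_span[of V t]
  by (intro pm.dim_mono_finite[of _ _ "chart_monomials t"]) (auto intro: pm.span_base)

lemma dim_forms_vanishing_separated:
  fixes W :: "('k ^ 3) set"
  assumes p: "p \<in> W" and sep: "separates W p t"
  shows "pm.dim (forms_vanishing (W - {p}) t) = Suc (pm.dim (forms_vanishing W t))"
proof -
  obtain f where f: "f \<in> forms_vanishing (W - {p}) t" "eval3 f p \<noteq> 0"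
    using sep by (auto simp: separates_def)
  have "forms_vanishing (W - {p}) t = pm.span (insert f (forms_vanishing W t))"
  proof
    show "forms_vanishing (W - {p}) t \<subseteq> pm.span (insert f (forms_vanishing W t))"
    proof
      fix g assume g: "g \<in> forms_vanishing (W - {p}) t"
      let ?a = "eval3 g p / eval3 f p"
      have "eval3 (g - pm_scale ?a f) q = 0" if "q \<in> W" for q
        using f g that by (cases "q = p") (auto simp: forms_vanishing_def)
      then have "g - pm_scale ?a f \<in> forms_vanishing W t"
        using f(1) g by (auto simp: forms_vanishing_def)
      moreover have "g = g - pm_scale ?a f + pm_scale ?a f" by simp
      ultimately show "g \<in> pm.span (insert f (forms_vanishing W t))"
        using pm.span_insert_eq[OF subspace_forms_vanishing, of f W t] by blast
    qed
    show "pm.span (insert f (forms_vanishing W t)) \<subseteq> forms_vanishing (W - {p}) t"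
      using f(1) forms_vanishing_antimono[of "W - {p}" W t] by (intro pm.span_minimal) auto
  qed
  moreover have "f \<notin> forms_vanishing W t" using f(2) p by (auto simp: forms_vanishing_def)
  ultimately show ?thesis
    using pm.dim_span_insert[OF subspace_forms_vanishing forms_vanishing_span finite_chart_monomials] by simp
qed

lemma dim_forms_vanishing_independent:
  fixes W :: "('k ^ 3) set"
  assumes "finite W" "independent_conditions W t"
  shows "pm.dim (homog t :: 'k poly3 set) = pm.dim (forms_vanishing W t) + card W"
  using assms
proof (induction W)
  case (insert p W)
  have "pm.dim (forms_vanishing (insert p W - {p}) t) = Suc (pm.dim (forms_vanishing (insert p W) t))"
    using insert.prems by (intro dim_forms_vanishing_separated) (auto simp: independent_conditions_def)
  moreover have "independent_conditions W t"
    using independent_conditions_subset[OF insert.prems] by blast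
  ultimately show ?case using insert by simp
qed simp

lemma pts_hilbert_independent:
  fixes W :: "('k ^ 3) set"
  assumes "finite W" "independent_conditions W t"
  shows "pts_hilbert W t = card W"
  using dim_forms_vanishing_independent[OF assms] by (simp add: pts_hilbert_def)

lemma pts_hilbert_mono:
  fixes W :: "('k ^ 3) set"
  assumes "V \<subseteq> W"
  shows "pts_hilbert V t \<le> pts_hilbert W t"
  unfolding pts_hilbert_def by (intro diff_le_mono2 dim_forms_vanishing_mono forms_vanishing_antimono assms)

lemma separates_Suc:
  assumes "separates W p t" "p \<in> chart"
  shows "separates W p (Suc t)"
proof -
  obtain f where f: "f \<in> forms_vanishing (W - {p}) t" "eval3 f p \<noteq> 0"
    using assms by (auto simp: separates_def)
  have "L * f \<in> forms_vanishing (W - {p}) (Suc t)" using forms_vanishing_mult[OF L_homog f(1)] by simp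
  then show ?thesis using f(2) eval3_L[OF assms(2)] by (auto simp: separates_def intro!: bexI[of _ "L * f"])
qed

lemma independent_conditions_mono:
  assumes "independent_conditions W t" "W \<subseteq> chart" "t \<le> t'"
  shows "independent_conditions W t'"
  using assms(3,1) separates_Suc assms(2)
  by (induction rule: dec_induct) (auto simp: independent_conditions_def)

text \<open>A product of \<open>card W - 1\<close> lines, one through each other point and none
  through \<open>p\<close>, separates \<open>p\<close>.\<close>

lemma exists_independent_degree:
  assumes "finite W" "W \<subseteq> chart"
  shows "\<exists>t. independent_conditions W t"
proof -
  have "separates W p (card W - 1)" if p: "p \<in> W" for p
  proof -
    have "\<exists>l\<in>homog (Suc 0). eval3 l q = 0 \<and> eval3 l p \<noteq> 0" if q: "q \<in> W - {p}" for q
    proof (cases "q $ 1 = p $ 1")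
      case True
      then have "q $ 2 \<noteq> p $ 2" using chart_eqI[of q p] p q assms(2) by (auto simp: subset_iff)
      then show ?thesis using p q assms(2)
        by (intro bexI[of _ "z - pm_scale (q $ 2) L"]) (auto simp: subset_iff eval3_L)
    next
      case False
      then show ?thesis using p q assms(2)
        by (intro bexI[of _ "y - pm_scale (q $ 1) L"]) (auto simp: subset_iff eval3_L)
    qed
    then obtain l where l: "\<And>q. q \<in> W - {p} \<Longrightarrow> l q \<in> homog (Suc 0) \<and> eval3 (l q) q = 0 \<and> eval3 (l q) p \<noteq> 0"
      by metis
    have ev: "eval3 (\<Prod>q\<in>A. l q) x = (\<Prod>q\<in>A. eval3 (l q) x)" for A x
      by (induction A rule: infinite_finite_induct) auto
    have hom: "(\<Prod>q\<in>A. l q) \<in> homog (card A)" if "finite A" "A \<subseteq> W - {p}" for A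
      using that
    proof (induction A)
      case (insert q A)
      then show ?case using homog_mult[of "l q" "Suc 0" "\<Prod>q\<in>A. l q" "card A"] l by auto
    qed auto
    have "(\<Prod>q\<in>W - {p}. l q) \<in> homog (card W - 1)"
      using hom[of "W - {p}"] assms(1) p by simp
    moreover have "eval3 (\<Prod>q\<in>W - {p}. l q) x = 0" if "x \<in> W - {p}" for x
      unfolding ev using l that assms(1) by (intro prod_zero) auto
    moreover have "eval3 (\<Prod>q\<in>W - {p}. l q) p \<noteq> 0"
      unfolding ev using l assms(1) by (simp add: prod_zero_iff)
    ultimately show ?thesis by (auto simp: separates_def forms_vanishing_def)
  qed
  then show ?thesis by (auto simp: independent_conditions_def)
qed

text \<open>Multiplication by a power of \<open>L\<close>, which is 1 at all the points, moves a
  form up to degree \<open>t'\<close> without changing its values.\<close>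

lemma forms_vanishing_eq_lower:
  assumes eq: "forms_vanishing V t' = forms_vanishing W t'" and le: "t \<le> t'" and VW: "V \<subseteq> W" and W: "W \<subseteq> chart"
  shows "forms_vanishing V t = forms_vanishing W t"
proof
  show "forms_vanishing V t \<subseteq> forms_vanishing W t"
  proof
    fix f assume f: "f \<in> forms_vanishing V t"
    have "L ^ (t' - t) * f \<in> forms_vanishing V (t' - t + t)"
      using homog_power[OF L_homog, of "t' - t"] by (intro forms_vanishing_mult f) simp
    then have "L ^ (t' - t) * f \<in> forms_vanishing W t'" using le eq by simp
    then have "eval3 f p = 0" if "p \<in> W" for p
      using that eval3_L[of p] W by (auto simp: forms_vanishing_def subset_iff)
    then show "f \<in> forms_vanishing W t" using f by (auto simp: forms_vanishing_def)
  qed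
qed (rule forms_vanishing_antimono[OF VW])

lemma separated_pointsI:
  assumes "finite W" "W \<subseteq> chart" "independent_conditions W s"
  shows "\<exists>F. separated_points c W s F"
proof -
  have "\<exists>G\<in>homog s. \<forall>q\<in>W. eval3 G q = (if p = q then 1 else 0)" if "p \<in> W" for p
  proof -
    have "separates W p s" using assms(3) that by (simp add: independent_conditions_def)
    then obtain f where f: "f \<in> forms_vanishing (W - {p}) s" "eval3 f p \<noteq> 0"
      unfolding separates_def ..
    then show ?thesis
      by (intro bexI[of _ "pm_scale (1 / eval3 f p) f"]) (auto simp: forms_vanishing_def)
  qed
  then have "\<forall>p\<in>W. \<exists>G. G \<in> homog s \<and> (\<forall>q\<in>W. eval3 G q = (if p = q then 1 else 0))"
    by blast
  from bchoice[OF this] obtain F where F: "\<forall>p\<in>W. F p \<in> homog s \<and> (\<forall>q\<in>W. eval3 (F p) q = (if p = q then 1 else 0))" ..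
  show ?thesis using assms(1,2) F by (intro exI[of _ F]) (unfold_locales; auto)
qed

text \<open>This is the Castelnuovo-Mumford step: separators in degree \<open>t\<close> put all
  \<open>u p\<close> and \<open>v p\<close> of degree \<open>t + 2\<close> into \<open>T\<close>, by
  \<open>uv_in_T\<close>.\<close>

lemma linear_multiples_full:
  assumes "finite W" "W \<subseteq> chart" "independent_conditions W t"
  shows "linear_multiples (forms_vanishing W (Suc t)) = forms_vanishing W (Suc (Suc t))"
proof
  have "independent_conditions W (Suc t)"
    by (rule independent_conditions_mono[OF assms(3,2)]) simp
  then obtain F where "separated_points c W (Suc t) F"
    using separated_pointsI[OF assms(1,2)] by blast
  then interpret sp: separated_points c W "Suc t" F .
  show "forms_vanishing W (Suc (Suc t)) \<subseteq> linear_multiples (forms_vanishing W (Suc t))"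
    using assms(3) by (intro sp.linear_multiples_eqI sp.uv_in_T) (auto simp: independent_conditions_def)
qed (rule linear_multiples_forms_vanishing)

section \<open>Choice of the subset within one chart\<close>

text \<open>Here \<open>Suc t\<close> is the critical degree. The alternative is inherited by
  further removals: either 3 dimensions are gained again, or the map is surjective, and surjectivity
  persists by \<open>removal_full\<close>.\<close>

lemma removal_chain:
  assumes Y: "finite Y" "Y \<subseteq> chart" "independent_conditions Y (Suc t)" and n: "n \<le> card Y - pts_hilbert Y t"
  shows "\<exists>Z\<subseteq>Y. card Z = card Y - n \<and> forms_vanishing Z t = forms_vanishing Y t \<and>
    (forms_vanishing Z (Suc (Suc t)) \<subseteq> linear_multiples (forms_vanishing Z (Suc t)) \<or>
     pm.dim (linear_multiples (forms_vanishing Y (Suc t))) + 3 * n \<le> pm.dim (linear_multiples (forms_vanishing Z (Suc t))))"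
  using n
proof (induction n)
  case 0
  show ?case by (rule exI[of _ Y]) auto
next
  case (Suc n)
  then obtain Z where Z: "Z \<subseteq> Y" "card Z = card Y - n" "forms_vanishing Z t = forms_vanishing Y t"
    and dis: "forms_vanishing Z (Suc (Suc t)) \<subseteq> linear_multiples (forms_vanishing Z (Suc t)) \<or>
     pm.dim (linear_multiples (forms_vanishing Y (Suc t))) + 3 * n \<le> pm.dim (linear_multiples (forms_vanishing Z (Suc t)))"
    by auto
  have fZ: "finite Z" "Z \<subseteq> chart" "independent_conditions Z (Suc t)"
    using Z(1) Y finite_subset independent_conditions_subset by blast+
  obtain F where "separated_points c Z (Suc t) F"
    using separated_pointsI[OF fZ] by auto
  then interpret sp: separated_points c Z "Suc t" F .
  \<comment> \<open>The bound on \<open>n\<close> leaves more points in \<open>Z\<close> than the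
    unchanged Hilbert function in degree \<open>t\<close>, so some point is still not
    separated.\<close>
  have "\<not> independent_conditions Z t"
  proof
    assume "independent_conditions Z t"
    then have "pts_hilbert Z t = card Z" by (rule pts_hilbert_independent[OF fZ(1)])
    moreover have "pts_hilbert Z t = pts_hilbert Y t" using Z(3) by (simp add: pts_hilbert_def)
    ultimately have "card Z = pts_hilbert Y t" by simp
    then show False using Suc.prems Z(2) by simp
  qed
  then obtain p where p: "p \<in> Z" "\<not> separates Z p t"
    and dis': "forms_vanishing (Z - {p}) (Suc (Suc t)) \<subseteq> linear_multiples (forms_vanishing (Z - {p}) (Suc t)) \<or>
      pm.dim (linear_multiples (forms_vanishing Z (Suc t))) + 3 \<le> pm.dim (linear_multiples (forms_vanishing (Z - {p}) (Suc t)))"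
    using sp.exists_good_removal[OF refl] unfolding independent_conditions_def by blast
  have "forms_vanishing (Z - {p}) (Suc (Suc t)) \<subseteq> linear_multiples (forms_vanishing (Z - {p}) (Suc t)) \<or>
     pm.dim (linear_multiples (forms_vanishing Y (Suc t))) + 3 * Suc n \<le> pm.dim (linear_multiples (forms_vanishing (Z - {p}) (Suc t)))"
    using dis dis' sp.removal_full[OF p(1)] sp.T_subset_removal[of p] by fastforce
  moreover have "card (Z - {p}) = card Y - Suc n" using p(1) fZ(1) Z(2) by simp
  ultimately show ?case
    using Z forms_vanishing_not_separated[OF p(2)] by (intro exI[of _ "Z - {p}"]) auto
qed

lemma exists_subset_of_chart_points:
  assumes X: "finite X" "X \<subseteq> chart" and m: "m \<le> card X"
  shows "\<exists>Z\<subseteq>X. card Z = m \<and> (\<forall>t. pts_hilbert Z t = min (pts_hilbert X t) m) \<and>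
    (\<forall>s\<ge>1. int (pm.dim (linear_multiples (forms_vanishing Z s))) =
      min (int (pm.dim (forms_vanishing Z (Suc s))))
        (int (pm.dim (linear_multiples (forms_vanishing X s))) + 3 * int (pm.dim (forms_vanishing Z s))
          - 3 * int (pm.dim (forms_vanishing X s))))"
proof -
  obtain t1 where "independent_conditions X t1" using exists_independent_degree[OF X] by blast
  then have "m \<le> pts_hilbert X t1" using pts_hilbert_independent X(1) m by simp
  define s0 where "s0 = (LEAST t. m \<le> pts_hilbert X t)"
  have s0: "m \<le> pts_hilbert X s0"
    unfolding s0_def by (rule LeastI) fact
  have below: "pts_hilbert X t < m" if "t < s0" for t
    using not_less_Least[of t] that unfolding s0_def by (meson not_le)
  obtain Y where Y: "Y \<subseteq> X" "forms_vanishing Y s0 = forms_vanishing X s0" "independent_conditions Y s0"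
    using exists_independent_subset[OF X(1)] by blast
  have fY: "finite Y" "Y \<subseteq> chart" using X Y(1) finite_subset by blast+
  have cY: "card Y = pts_hilbert X s0"
    using pts_hilbert_independent[OF fY(1) Y(3)] Y(2) by (simp add: pts_hilbert_def)
  have eqYX: "forms_vanishing Y t = forms_vanishing X t" if "t \<le> s0" for t
    by (rule forms_vanishing_eq_lower[OF Y(2) that Y(1) X(2)])
  have "\<exists>Z\<subseteq>Y. card Z = m \<and> (\<forall>t. s0 = Suc t \<longrightarrow> forms_vanishing Z t = forms_vanishing Y t \<and>
    (forms_vanishing Z (Suc s0) \<subseteq> linear_multiples (forms_vanishing Z s0) \<or>
     pm.dim (linear_multiples (forms_vanishing Y s0)) + 3 * (card Y - m) \<le> pm.dim (linear_multiples (forms_vanishing Z s0))))"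
  proof (cases s0)
    case 0
    \<comment> \<open>There is no degree below \<open>s0 = 0\<close> to preserve, and the rank
      formula starts at \<open>s = 1\<close>, so any \<open>m\<close> points of \<open>Y\<close>
      will do.\<close>
    obtain Z where "Z \<subseteq> Y" "card Z = m"
      using obtain_subset_with_card_n[of m Y] cY s0 by metis
    then show ?thesis using 0 by auto
  next
    case (Suc t)
    have "pts_hilbert Y t = pts_hilbert X t" using eqYX[of t] Suc by (simp add: pts_hilbert_def)
    then have "card Y - m \<le> card Y - pts_hilbert Y t" using below[of t] Suc by simp
    from removal_chain[OF fY Y(3)[unfolded Suc] this]
    obtain Z where "Z \<subseteq> Y" "card Z = card Y - (card Y - m)" "forms_vanishing Z t = forms_vanishing Y t"
      "forms_vanishing Z (Suc (Suc t)) \<subseteq> linear_multiples (forms_vanishing Z (Suc t)) \<or>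
       pm.dim (linear_multiples (forms_vanishing Y (Suc t))) + 3 * (card Y - m) \<le> pm.dim (linear_multiples (forms_vanishing Z (Suc t)))"
      by blast
    then show ?thesis using Suc s0 cY by (intro exI[of _ Z]) auto
  qed
  then obtain Z where Z: "Z \<subseteq> Y" "card Z = m"
    and Zt: "\<And>t. s0 = Suc t \<Longrightarrow> forms_vanishing Z t = forms_vanishing Y t"
    and Zs: "\<And>t. s0 = Suc t \<Longrightarrow> forms_vanishing Z (Suc s0) \<subseteq> linear_multiples (forms_vanishing Z s0) \<or>
     pm.dim (linear_multiples (forms_vanishing Y s0)) + 3 * (card Y - m) \<le> pm.dim (linear_multiples (forms_vanishing Z s0))"
    by blast
  have ZX: "Z \<subseteq> X" using Z(1) Y(1) by blast
  have fZ: "finite Z" "Z \<subseteq> chart" using Z(1) fY finite_subset by blast+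
  have indZ: "independent_conditions Z t" if "s0 \<le> t" for t
    using independent_conditions_mono[OF independent_conditions_subset[OF Y(3) Z(1)] fZ(2) that] .
  have eqZX: "forms_vanishing Z t = forms_vanishing X t" if lt: "t < s0" for t
  proof -
    obtain t' where t': "s0 = Suc t'" using lt by (cases s0) auto
    have "forms_vanishing Z t = forms_vanishing Y t"
      using t' lt by (intro forms_vanishing_eq_lower[OF Zt[OF t'] _ Z(1) fY(2)]) simp
    then show ?thesis using eqYX[of t] lt by simp
  qed
  have h: "pts_hilbert Z t = min (pts_hilbert X t) m" for t
  proof (cases "t < s0")
    case True
    then show ?thesis using below[OF True] eqZX[OF True] by (simp add: pts_hilbert_def)
  next
    case False
    then have "pts_hilbert Z t = m" using pts_hilbert_independent[OF fZ(1) indZ] Z(2) by simp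
    then show ?thesis using pts_hilbert_mono[OF ZX, of t] by simp
  qed
  \<comment> \<open>The rank for \<open>Z\<close> is at most both entries of the minimum in every
    degree. It remains to attain one of them.\<close>
  have upper: "pm.dim (linear_multiples (forms_vanishing Z s)) \<le> pm.dim (forms_vanishing Z (Suc s))"
    "pm.dim (linear_multiples (forms_vanishing Z s)) + 3 * pm.dim (forms_vanishing X s)
      \<le> pm.dim (linear_multiples (forms_vanishing X s)) + 3 * pm.dim (forms_vanishing Z s)" for s
  proof -
    show "pm.dim (linear_multiples (forms_vanishing Z s)) \<le> pm.dim (forms_vanishing Z (Suc s))"
      using linear_multiples_forms_vanishing[of Z s] forms_vanishing_span finite_chart_monomials
      by (intro pm.dim_mono_finite[of _ _ "chart_monomials (Suc s)"]) (auto intro: pm.span_base)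
    show "pm.dim (linear_multiples (forms_vanishing Z s)) + 3 * pm.dim (forms_vanishing X s)
      \<le> pm.dim (linear_multiples (forms_vanishing X s)) + 3 * pm.dim (forms_vanishing Z s)"
      using linear_multiples_forms_vanishing[of X s] forms_vanishing_span[of X "Suc s"]
        linear_multiples_forms_vanishing[of Z s] forms_vanishing_span[of Z "Suc s"]
      by (intro dim_linear_multiples_le[OF subspace_forms_vanishing forms_vanishing_antimono[OF ZX]
          forms_vanishing_span finite_chart_monomials subspace_forms_vanishing order_trans
          finite_chart_monomials])
  qed
  have full: "pm.dim (linear_multiples (forms_vanishing Z s)) = pm.dim (forms_vanishing Z (Suc s))"
    if "forms_vanishing Z (Suc s) \<subseteq> linear_multiples (forms_vanishing Z s)" for s
    using that linear_multiples_forms_vanishing[of Z s] by (metis subset_antisym)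
  have r: "int (pm.dim (linear_multiples (forms_vanishing Z s))) =
      min (int (pm.dim (forms_vanishing Z (Suc s))))
        (int (pm.dim (linear_multiples (forms_vanishing X s))) + 3 * int (pm.dim (forms_vanishing Z s))
          - 3 * int (pm.dim (forms_vanishing X s)))" if s: "s \<ge> 1" for s
  proof -
    consider "s < s0" | "s = s0" | "s > s0" by linarith
    then show ?thesis
    proof cases
      case 1
      \<comment> \<open>Below \<open>s0\<close> the degree \<open>s\<close> parts for
        \<open>Z\<close> and \<open>X\<close> coincide, so the second entry is the rank
        itself.\<close>
      then show ?thesis using eqZX[OF 1] upper(1)[of s] by simp
    next
      case 2
      then obtain t where t: "s0 = Suc t" using s by (cases s) auto
      \<comment> \<open>Both sets impose independent conditions, so the ideal grows by
        \<open>card Y - m\<close> in degree \<open>s0\<close>. The alternative from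
        \<open>removal_chain\<close> then attains the first or the second entry.\<close>
      have "pm.dim (forms_vanishing Z s) + m = pm.dim (forms_vanishing Y s) + card Y"
        using dim_forms_vanishing_independent[OF fZ(1) indZ] dim_forms_vanishing_independent[OF fY(1) Y(3)] Z(2) 2 by simp
      moreover have "m \<le> card Y" using s0 cY by simp
      ultimately show ?thesis
        using Zs[OF t] full[of s] upper[of s] eqYX[of s] 2 by auto
    next
      case 3
      then obtain t where t: "s = Suc t" "s0 \<le> t" by (cases s) auto
      show ?thesis
        using linear_multiples_full[OF fZ indZ[OF t(2)]] upper[of s] t(1) by simp
    qed
  qed
  show ?thesis using ZX Z(2) h r by blast
qed

end

section \<open>From ideals, quotient rings and tensor products to vector spaces of forms\<close>

lemma polyring_sel [simp]:
  "carrier polyring = UNIV" "x \<otimes>\<^bsub>polyring\<^esub> x' = x * x'" "x \<oplus>\<^bsub>polyring\<^esub> x' = x + x'"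
  "\<one>\<^bsub>polyring\<^esub> = 1" "\<zero>\<^bsub>polyring\<^esub> = 0"
  by (simp_all add: polyring_def)

lemma ring_polyring: "ring polyring"
  using cring_polyring by (rule cring.axioms)

lemma polyring_uminus [simp]: "\<ominus>\<^bsub>polyring\<^esub> f = - f"
proof -
  interpret R: ring "polyring :: 'a poly3 ring" by (rule ring_polyring)
  show ?thesis by (rule R.minus_equality) simp_all
qed

lemma polyring_minus [simp]: "f \<ominus>\<^bsub>polyring\<^esub> g = f - g"
  by (simp add: a_minus_def)

lemma subfield_constants: "subfield constants polyring"
proof -
  interpret R: cring "polyring :: 'a poly3 ring" by (rule cring_polyring)
  have sub: "subring constants (polyring :: 'a poly3 ring)"
  proof (rule R.subringI)
    show "(constants :: 'a poly3 set) \<subseteq> carrier polyring" by simp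
    show "\<one>\<^bsub>polyring\<^esub> \<in> (constants :: 'a poly3 set)" by (simp add: constants_def flip: single_one)
    show "\<ominus>\<^bsub>polyring\<^esub> h \<in> constants" if "h \<in> constants" for h :: "'a poly3"
      using that by (auto simp: constants_def simp flip: single_uminus)
    show "h \<otimes>\<^bsub>polyring\<^esub> h' \<in> constants" if "h \<in> constants" "h' \<in> constants" for h h' :: "'a poly3"
      using that by (auto simp: constants_def mult_single)
    show "h \<oplus>\<^bsub>polyring\<^esub> h' \<in> constants" if "h \<in> constants" "h' \<in> constants" for h h' :: "'a poly3"
      using that by (auto simp: constants_def simp flip: single_add)
  qed
  show ?thesis
  proof (rule R.subfieldI)
    show "subcring constants (polyring :: 'a poly3 ring)"
      using sub by (rule R.subcringI) (auto simp: mult.commute)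
    show "Units (polyring\<lparr>carrier := constants\<rparr>) = constants - {\<zero>\<^bsub>polyring\<^esub> :: 'a poly3}"
    proof (intro equalityI subsetI)
      fix x :: "'a poly3" assume "x \<in> constants - {\<zero>\<^bsub>polyring\<^esub>}"
      then obtain a where a: "x = Poly_Mapping.single 0 a" by (auto simp: constants_def)
      have "a \<noteq> 0" using \<open>x \<in> _\<close> a by auto
      then have "x * Poly_Mapping.single 0 (inverse a) = 1"
        by (simp add: a mult_single flip: single_one)
      then show "x \<in> Units (polyring\<lparr>carrier := constants\<rparr>)"
        using a by (auto simp: Units_def constants_def mult.commute intro!: exI[of _ "Poly_Mapping.single 0 (inverse a)"])
    qed (auto simp: Units_def)
  qed
qed

lemma pm_scale_eq_mult: "pm_scale a f = Poly_Mapping.single 0 a * (f :: 'k::field poly3)"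
proof -
  have "pm_scale a f = pm_scale a 1 * f" by (simp add: pm_scale_mult_left)
  also have "pm_scale a 1 = (Poly_Mapping.single 0 a :: 'k poly3)"
    by (rule poly_mapping_eqI) (auto simp: lookup_one lookup_single when_def)
  finally show ?thesis .
qed

lemma ideal_vanishing_ideal: "ideal (vanishing_ideal W) polyring"
proof -
  interpret R: ring "polyring :: 'a poly3 ring" by (rule ring_polyring)
  show ?thesis unfolding vanishing_ideal_def by (rule R.genideal_ideal) simp
qed

lemma vanishing_ideal_subset: "vanishing_ideal W \<subseteq> {f. \<forall>p\<in>W. \<forall>v\<in>p. eval3 f v = 0}"
proof -
  interpret R: ring "polyring :: 'a poly3 ring" by (rule ring_polyring)
  have "ideal {f. \<forall>p\<in>W. \<forall>v\<in>p. eval3 f v = 0} polyring"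
  proof (rule idealI[OF ring_polyring])
    have neg: "eval3 (- f) v = - eval3 f v" for f :: "'a poly3" and v
      using eval3_diff[of 0 f v] by simp
    show "subgroup {f. \<forall>p\<in>W. \<forall>v\<in>p. eval3 f v = 0} (add_monoid polyring)"
      by (rule R.add.subgroupI) (auto simp: neg simp flip: a_inv_def intro!: exI[of _ 0])
  qed auto
  then show ?thesis
    unfolding vanishing_ideal_def by (rule R.genideal_minimal) auto
qed

text \<open>The generated ideal acquires no further forms, because all its elements vanish on the
  coordinate vectors of the points.\<close>

lemma vanishing_ideal_deg_eq:
  "vanishing_ideal_deg W t = {f \<in> homog t. \<forall>p\<in>W. \<forall>v\<in>p. eval3 f v = 0}"
proof -
  interpret R: ring "polyring :: 'a poly3 ring" by (rule ring_polyring)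
  have "{f. (\<exists>t. f \<in> homog t) \<and> (\<forall>p\<in>W. \<forall>v\<in>p. eval3 f v = 0)} \<subseteq> vanishing_ideal W"
    unfolding vanishing_ideal_def by (rule R.genideal_self) simp
  then show ?thesis
    using vanishing_ideal_subset[of W] by (auto simp: vanishing_ideal_deg_def)
qed

lemma proj_plane_pointE:
  assumes "p \<in> proj_plane"
  obtains u where "u \<noteq> 0" "p = {a *s u | a. a \<noteq> 0}"
proof -
  obtain u where u: "u \<noteq> 0" "p = proj_rel `` {u}"
    using assms by (auto simp: proj_plane_def quotient_def)
  have "a *s u \<noteq> 0" if "a \<noteq> 0" for a
    using u(1) that by (simp add: vec_eq_iff)
  then have "p = {a *s u | a. a \<noteq> 0}"
    using u by (auto simp: proj_rel_def)
  then show ?thesis using that u(1) by blast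
qed

lemma eval3_vanishes_on_point_iff:
  assumes p: "p \<in> proj_plane" and v: "v \<in> p" and f: "f \<in> homog t"
  shows "(\<forall>w\<in>p. eval3 f w = 0) \<longleftrightarrow> eval3 f v = 0"
proof -
  obtain u where u: "u \<noteq> 0" "p = {a *s u | a. a \<noteq> 0}" using proj_plane_pointE[OF p] .
  have "eval3 f w = 0 \<longleftrightarrow> eval3 f u = 0" if "w \<in> p" for w
    using that u(2) eval3_homog_scaled[OF f] by auto
  then show ?thesis using v by blast
qed

text \<open>The dimension in the quotient ring is built up by line extensions. A chain of subspaces
  from \<open>I(W)_t\<close> to \<open>S_t\<close>, growing by one vector at a time, is therefore
  mapped to the quotient step by step.\<close>

lemma hilbert_fun_eq:
  assumes W: "W \<subseteq> proj_plane" "W \<noteq> {}"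
  shows "hilbert_fun W t = pm.dim (homog t :: 'k::field poly3 set) - pm.dim (vanishing_ideal_deg (W :: ('k ^ 3) set set) t)"
proof -
  define I where "I = vanishing_ideal W"
  define Q where "Q = polyring Quot I"
  define q where "q = (\<lambda>f. I +>\<^bsub>polyring\<^esub> f)"
  interpret R: cring "polyring :: 'k poly3 ring" by (rule cring_polyring)
  interpret I: ideal I polyring unfolding I_def by (rule ideal_vanishing_ideal)
  interpret q: ring_hom_ring polyring Q q
    unfolding Q_def q_def by (rule I.rcos_ring_hom_ring)
  interpret A: affine_chart "0 :: 'k" .
  have q_eq: "q f = q g \<longleftrightarrow> f - g \<in> I" for f g
    unfolding q_def using R.quotient_eq_iff_same_a_r_cos[OF I.is_ideal, of f g] by simp
  have q_add: "q (f + g) = q f \<oplus>\<^bsub>Q\<^esub> q g" and q_mult: "q (f * g) = q f \<otimes>\<^bsub>Q\<^esub> q g" for f g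
    using q.hom_add[of f g] q.hom_mult[of f g] by simp_all
  have q0: "q 0 = \<zero>\<^bsub>Q\<^esub>" using q.hom_zero by simp
  \<comment> \<open>A point of \<open>W\<close> provides a vector at which 1 does not vanish. Thus
    the quotient is nonzero and the constants map onto a subfield.\<close>
  have "1 \<notin> I"
  proof
    assume "1 \<in> I"
    obtain p where p: "p \<in> W" using W(2) by blast
    then obtain v where "v \<in> p" using W(1) proj_plane_pointE[of p] by (metis (mono_tags, lifting) mem_Collect_eq one_neq_zero subsetD)
    then show False using \<open>1 \<in> I\<close> vanishing_ideal_subset[of W] p unfolding I_def by force
  qed
  then have "\<one>\<^bsub>Q\<^esub> \<noteq> \<zero>\<^bsub>Q\<^esub>"
    using q_eq[of 1 0] q.hom_one q0 by simp
  then have K: "subfield (q ` constants) Q"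
    by (rule q.img_is_subfield(2)[OF subfield_constants])
  let ?V = "vanishing_ideal_deg W t"
  have V: "?V = I \<inter> homog t" by (simp add: vanishing_ideal_deg_def I_def)
  have sV: "pm.subspace ?V"
    unfolding vanishing_ideal_deg_eq by (rule pm.subspaceI) (auto intro: pm.subspace_0[OF subspace_homog])
  let ?B = "A.chart_monomials t"
  have VB: "U \<subseteq> pm.span ?B" if "U \<subseteq> homog t" for U
    using A.homog_subset_span that by blast
  have dims: "\<exists>U. pm.subspace U \<and> ?V \<subseteq> U \<and> U \<subseteq> homog t \<and> pm.dim U = pm.dim ?V + n \<and>
      q.S.dimension n (q ` constants) (q ` U)" if "n \<le> pm.dim (homog t :: 'k poly3 set) - pm.dim ?V" for n
    using that
  proof (induction n)
    case 0
    have "q f = \<zero>\<^bsub>Q\<^esub>" if "f \<in> ?V" for f using q_eq[of f 0] that q0 by (simp add: V)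
    then have "q ` ?V = {\<zero>\<^bsub>Q\<^esub>}" using pm.subspace_0[OF sV] by auto
    then show ?case using sV by (intro exI[of _ ?V]) (auto simp: V)
  next
    case (Suc n)
    then obtain U where U: "pm.subspace U" "?V \<subseteq> U" "U \<subseteq> homog t" "pm.dim U = pm.dim ?V + n"
      "q.S.dimension n (q ` constants) (q ` U)" by auto
    have "U \<noteq> homog t" using U(4) Suc.prems by auto
    then obtain x where x: "x \<in> homog t" "x \<notin> U" using U(3) by blast
    let ?U = "pm.span (insert x U)"
    have hom: "?U \<subseteq> homog t" using x U(3) by (intro pm.span_minimal) auto
    \<comment> \<open>\<open>U\<close> contains all of \<open>I(W)_t\<close>, so a form outside
      \<open>U\<close> stays outside modulo the ideal.\<close>
    have "q x \<notin> q ` U"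
    proof
      assume "q x \<in> q ` U"
      then obtain w where w: "w \<in> U" "x - w \<in> I" using q_eq by auto
      then have "x - w \<in> ?V" using x U(3) by (auto simp: V)
      then have "w + (x - w) \<in> U" using U(2) w(1) by (intro pm.subspace_add[OF U(1)]) auto
      then show False using x(2) by simp
    qed
    moreover have "q ` ?U = q.S.line_extension (q ` constants) (q x) (q ` U)"
    proof -
      have "q (w + pm_scale a x) = q (Poly_Mapping.single 0 a) \<otimes>\<^bsub>Q\<^esub> q x \<oplus>\<^bsub>Q\<^esub> q w" for w a
        unfolding pm_scale_eq_mult add.commute[of w] q_add q_mult ..
      then show ?thesis
        unfolding pm.span_insert_eq[OF U(1)] q.S.line_extension_mem_iff set_eq_iff image_iff constants_def
        by (auto; metis)
    qed
    moreover have "q x \<in> carrier Q" using q.hom_closed[of x] by simp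
    ultimately have "q.S.dimension (Suc n) (q ` constants) (q ` ?U)"
      using q.S.dimension.Suc_dim[OF _ _ U(5)] by simp
    moreover have "pm.dim ?U = pm.dim ?V + Suc n"
      using pm.dim_span_insert[OF U(1) VB[OF U(3)] A.finite_chart_monomials x(2)] U(4) by simp
    moreover have "?V \<subseteq> ?U" using U(2) by (auto intro: pm.span_base)
    ultimately show ?case using hom by (intro exI[of _ ?U]) auto
  qed
  have le: "pm.dim ?V \<le> pm.dim (homog t :: 'k poly3 set)"
    using VB[of "homog t"] A.finite_chart_monomials
    by (intro pm.dim_mono_finite[of _ _ ?B]) (auto simp: V intro: pm.span_base)
  obtain U where U: "pm.subspace U" "U \<subseteq> homog t" "pm.dim U = pm.dim (homog t :: 'k poly3 set)"
    "q.S.dimension (pm.dim (homog t :: 'k poly3 set) - pm.dim ?V) (q ` constants) (q ` U)"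
    using dims[OF order_refl] le by auto
  have "U = homog t"
    using U A.finite_chart_monomials VB[of "homog t"] by (intro pm.subspace_eq_if_dim_le[of _ _ ?B]) auto
  then have "q.S.dim (q ` constants) (q ` homog t) = pm.dim (homog t :: 'k poly3 set) - pm.dim ?V"
    using q.S.dimI[OF K U(4)] by (simp add: over_def)
  then show ?thesis
    unfolding hilbert_fun_def Let_def Q_def q_def I_def by simp
qed

lemma rank_mu_eq: "rank_mu s W = pm.dim (linear_multiples (vanishing_ideal_deg W s))"
proof -
  interpret m: Vector_Spaces.linear pm_scale pm_scale "mult_map :: _ \<Rightarrow> 'a poly3" by (rule linear_mult_map)
  have "mult_map ` {pure_tensor f g |f g. f \<in> homog 1 \<and> g \<in> vanishing_ideal_deg W s} =
      {f * g |f g. f \<in> homog 1 \<and> g \<in> vanishing_ideal_deg W s}"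
    unfolding mult_map_pure_tensor[symmetric] by blast
  then show ?thesis
    unfolding rank_mu_def mu_domain_def tensor_space_def linear_multiples_def m.span_image[symmetric] by simp
qed

lemma homog_1_span: "homog 1 = pm.span (range var)"
proof
  show "homog 1 \<subseteq> pm.span (range (var :: 3 \<Rightarrow> 'k::field poly3))"
  proof
    fix l :: "'k poly3" assume "l \<in> homog 1"
    then obtain h where h: "\<And>i. h i \<in> homog 0" "l = (\<Sum>i\<in>UNIV. var i * h i)"
      using homog_Suc_decomp_vars[of l 0] by auto
    have "var i * h i \<in> pm.span (range (var :: 3 \<Rightarrow> 'k poly3))" for i
    proof -
      obtain a where "h i = pm_scale a 1" using h(1)[of i] by (auto simp: homog_0)
      then have "var i * h i = pm_scale a (var i)" by (simp add: pm_scale_mult_right)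
      then show ?thesis by (simp add: pm.span_scale pm.span_base)
    qed
    then show "l \<in> pm.span (range (var :: 3 \<Rightarrow> 'k poly3))" unfolding h(2) by (rule pm.span_sum)
  qed
qed (rule pm.span_minimal; auto)

text \<open>Evaluation at the unit vectors gives the basis dual to the variables.\<close>

lemma dim_homog_1: "pm.dim (homog 1 :: 'k::field poly3 set) = 3"
proof -
  have ev: "eval3 (var i) (axis j 1) = (if i = j then 1 else 0 :: 'k)" for i j
    by (simp add: axis_def)
  have inj: "inj (var :: 3 \<Rightarrow> 'k poly3)"
    by (rule injI) (metis ev zero_neq_one)
  have "pm.independent (range (var :: 3 \<Rightarrow> 'k poly3))"
  proof (rule pm.independent_if_scalars_zero)
    fix a :: "'k poly3 \<Rightarrow> 'k" and x :: "'k poly3"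
    assume 0: "(\<Sum>x\<in>range var. pm_scale (a x) x) = 0" and "x \<in> range var"
    then obtain j where j: "x = var j" by blast
    have "(\<Sum>i\<in>UNIV. pm_scale (a (var i)) (var i)) = (0 :: 'k poly3)"
      using 0 unfolding sum.reindex[OF inj] o_def .
    then have "0 = eval3 (\<Sum>i\<in>UNIV. pm_scale (a (var i)) (var i)) (axis j 1)"
      by simp
    also have "\<dots> = (\<Sum>i\<in>UNIV. if i = j then a (var j) else 0)"
      unfolding eval3_sum by (intro sum.cong refl) (auto simp: ev simp del: eval3_var)
    finally show "a x = 0" using j by simp
  qed simp
  then have "pm.dim (homog 1 :: 'k poly3 set) = card (range (var :: 3 \<Rightarrow> 'k poly3))"
    unfolding homog_1_span by (rule pm.dim_span_eq_card_independent)
  then show ?thesis using card_image[OF inj] by simp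
qed

lemma dim_mu_domain: "pm.dim (mu_domain s W) = 3 * pm.dim (vanishing_ideal_deg W s)"
proof -
  interpret A: affine_chart 0 .
  have "vanishing_ideal_deg W s \<subseteq> pm.span (A.chart_monomials s)"
    using A.homog_subset_span by (auto simp: vanishing_ideal_deg_def)
  from dim_tensor_space[OF finite_imageI[OF finite] eq_refl[OF homog_1_span] A.finite_chart_monomials this]
  show ?thesis by (simp only: mu_domain_def dim_homog_1)
qed

section \<open>Choice of a chart and of representatives\<close>

text \<open>Over a finite field the product of all \<open>x - a\<close>, increased by 1, has no
  root.\<close>

lemma infinite_alg_closed_field: "infinite (UNIV :: 'k::alg_closed_field set)"
proof
  assume fin: "finite (UNIV :: 'k set)"
  define p :: "'k poly" where "p = (\<Prod>a\<in>UNIV. [:- a, 1:]) + 1"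
  have deg: "degree (\<Prod>a\<in>UNIV. [:- a, 1:] :: 'k poly) = card (UNIV :: 'k set)"
    by (subst degree_prod_sum_eq) auto
  have "card (UNIV :: 'k set) > 0" using fin by (simp add: card_gt_0_iff)
  then have "degree p > 0" unfolding p_def using deg by (subst degree_add_eq_left) auto
  then obtain x where "poly p x = 0" using alg_closed_imp_poly_has_root by blast
  moreover have "poly (\<Prod>a\<in>UNIV. [:- a, 1:]) x = 0"
    using fin by (simp add: poly_prod prod_zero_iff)
  ultimately show False by (simp add: p_def)
qed

lemma exists_chart:
  fixes X :: "('k::alg_closed_field ^ 3) set set"
  assumes X: "X \<subseteq> proj_plane" "finite X"
  shows "\<exists>c. \<forall>p\<in>X. \<exists>v\<in>p. v \<in> affine_chart.chart c"
proof -
  have "\<exists>u. u \<noteq> 0 \<and> (\<forall>a. a \<noteq> 0 \<longrightarrow> a *s u \<in> p)" if p: "p \<in> X" for p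
  proof -
    obtain u where "u \<noteq> 0" "p = {a *s u | a. a \<noteq> 0}"
      using proj_plane_pointE[OF subsetD[OF X(1) p]] .
    then show ?thesis by blast
  qed
  then obtain u where u: "\<And>p. p \<in> X \<Longrightarrow> u p \<noteq> 0" "\<And>p a. p \<in> X \<Longrightarrow> a \<noteq> 0 \<Longrightarrow> a *s u p \<in> p"
    by metis
  \<comment> \<open>\<open>poly (P p) c\<close> is the value at \<open>u p\<close> of the form
    \<open>L\<close> belonging to \<open>c\<close>.\<close>
  define P where "P p = [:u p $ 0, u p $ 1, u p $ 2:]" for p
  have "P p \<noteq> 0" if "p \<in> X" for p
  proof
    assume "P p = 0"
    then have "u p $ i = 0" for i using exhaust_3[of i] three_eq_0 by (auto simp: P_def)
    then show False using u(1)[OF that] by (simp add: vec_eq_iff)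
  qed
  then have "finite (\<Union>p\<in>X. {c. poly (P p) c = 0})" using X(2) poly_roots_finite by blast
  then obtain c where c: "\<And>p. p \<in> X \<Longrightarrow> poly (P p) c \<noteq> 0"
    using ex_new_if_finite[OF infinite_alg_closed_field] by blast
  have "\<exists>v\<in>p. v \<in> affine_chart.chart c" if p: "p \<in> X" for p
  proof (intro bexI)
    let ?b = "poly (P p) c"
    show "inverse ?b *s u p \<in> p" using c[OF p] by (intro u(2)[OF p]) simp
    have "?b = u p $ 0 + c * u p $ 1 + c ^ 2 * u p $ 2"
      by (simp add: P_def algebra_simps power2_eq_square)
    then have "inverse ?b * (u p $ 0 + c * u p $ 1 + c ^ 2 * u p $ 2) = 1" using c[OF p] by simp
    then show "inverse ?b *s u p \<in> affine_chart.chart c"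
      by (simp add: affine_chart.chart_def algebra_simps)
  qed
  then show ?thesis by blast
qed

theorem theorem4p2:
  fixes X :: "('k::alg_closed_field ^ 3) set set" and d m :: nat
  assumes "X \<subseteq> proj_plane" and "finite X" and "card X = d"
    and "1 \<le> m" and "m < d"
  shows "\<exists>Z\<subseteq>X. card Z = m \<and>
    (\<forall>t. hilbert_fun Z t = min (hilbert_fun X t) m) \<and>
    (\<forall>s\<ge>1. int (rank_mu s Z) =
       min (int (pm.dim (vanishing_ideal_deg Z (s + 1))))
           (int (rank_mu s X) + int (pm.dim (mu_domain s Z)) - int (pm.dim (mu_domain s X))))"
proof -
  obtain c where c: "\<And>p. p \<in> X \<Longrightarrow> \<exists>v\<in>p. v \<in> affine_chart.chart c"
    using exists_chart[OF assms(1,2)] by blast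
  interpret affine_chart c .
  \<comment> \<open>\<open>r\<close> picks the representative with \<open>L = 1\<close>. It is
    injective because distinct points are disjoint classes, and vanishing of a form on a class can
    be tested at \<open>r p\<close>.\<close>
  obtain r where r: "\<And>p. p \<in> X \<Longrightarrow> r p \<in> p \<and> r p \<in> chart"
    using c by metis
  have inj: "inj_on r X"
  proof (rule inj_onI)
    fix p p' assume pp: "p \<in> X" "p' \<in> X" "r p = r p'"
    then have "p \<inter> p' \<noteq> {}" using r by (metis IntI empty_iff)
    then show "p = p'"
      using quotient_disj[OF equiv_proj_rel] assms(1) pp unfolding proj_plane_def by blast
  qed
  have deg: "vanishing_ideal_deg Z t = forms_vanishing (r ` Z) t" if Z: "Z \<subseteq> X" for Z t
  proof -
    have "(\<forall>w\<in>p. eval3 f w = 0) \<longleftrightarrow> eval3 f (r p) = 0" if "f \<in> homog t" "p \<in> Z" for f p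
      using eval3_vanishes_on_point_iff[of p "r p" f t] that Z assms(1) r by blast
    then show ?thesis
      unfolding vanishing_ideal_deg_eq forms_vanishing_def by auto
  qed
  have "finite (r ` X)" "r ` X \<subseteq> chart" "m \<le> card (r ` X)"
    using assms r by (auto simp: card_image[OF inj])
  from exists_subset_of_chart_points[OF this]
  obtain Y where Y: "Y \<subseteq> r ` X" "card Y = m"
    "\<And>t. pts_hilbert Y t = min (pts_hilbert (r ` X) t) m"
    "\<And>s. s \<ge> 1 \<Longrightarrow> int (pm.dim (linear_multiples (forms_vanishing Y s))) =
      min (int (pm.dim (forms_vanishing Y (Suc s))))
        (int (pm.dim (linear_multiples (forms_vanishing (r ` X) s))) + 3 * int (pm.dim (forms_vanishing Y s))
          - 3 * int (pm.dim (forms_vanishing (r ` X) s)))"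
    by blast
  obtain Z where Z: "Z \<subseteq> X" "Y = r ` Z" using Y(1) by (metis subset_imageE)
  have cardZ: "card Z = m" using Y(2) Z card_image[OF inj_on_subset[OF inj Z(1)]] by simp
  have ne: "Z \<noteq> {}" "X \<noteq> {}" using cardZ assms(4) Z(1) by auto
  have h: "hilbert_fun V t = pts_hilbert (r ` V) t" if "V \<subseteq> X" "V \<noteq> {}" for V t
    using hilbert_fun_eq[of V t] deg[OF that(1)] that assms(1) by (simp add: pts_hilbert_def subset_trans)
  show ?thesis
  proof (intro exI[of _ Z] conjI allI impI)
    fix t show "hilbert_fun Z t = min (hilbert_fun X t) m"
      using h[OF Z(1) ne(1)] h[OF order_refl ne(2)] Y(3) Z(2) by simp
  next
    fix s :: nat assume "s \<ge> 1"
    from Y(4)[OF this]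
    show "int (rank_mu s Z) = min (int (pm.dim (vanishing_ideal_deg Z (s + 1))))
        (int (rank_mu s X) + int (pm.dim (mu_domain s Z)) - int (pm.dim (mu_domain s X)))"
      unfolding rank_mu_eq dim_mu_domain deg[OF Z(1)] deg[OF order_refl] Z(2) by simp
  qed (use Z cardZ in auto)
qed
end
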